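(* Let $f:\mathbb{N}\to\mathbb{N}$ be a computable non-decreasing function such that $f(n)\in o(\log n)$ and $f\le\mathrm{id}$ (i.e. $f(n)\le n$ for all $n$), and let $X$ be an $f$-block gluing $\mathbb{Z}^2$-subshift of finite type. Then the language of $X$ is decidable.
   Context: Let $\mathcal{A}$ be a finite alphabet; $\mathcal{A}^{\mathbb{Z}^2}$ carries the product of the discrete topologies, and the shift is $(\sigma^{u}x)_{v}=x_{u+v}$ for $u,v\in\mathbb{Z}^2$. A $\mathbb{Z}^2$-subshift is a compact subset $X\subset\mathcal{A}^{\mathbb{Z}^2}$ with $\sigma^{u}X\subset X$ for all $u\in\mathbb{Z}^2$. It is of finite type (SFT) if it is the set of configurations in which no translate of a pattern from some fixed finite set of patterns on finite supports appears. The language of $X$ is the set of finite patterns that appear in configurations of $X$; it is decidable if there is an algorithm deciding, given a finite pattern over $\mathcal{A}$, whether it belongs to the language. An $n$-block is an element of $\mathcal{A}^{\{0,\dots,n-1\}^2}$. For $n$-blocks $p,q$ in the language of $X$, $$\Delta_X(p,q)=\{u\in\mathbb{Z}^2:\ \exists x\in X,\ x_{\{0,\dots,n-1\}^2}=q\ \text{and}\ x_{u+\{0,\dots,n-1\}^2}=p\}.$$ $X$ is $f$-block gluing if for every $n$ and all $n$-blocks $p,q$ in the language of $X$, every $u\in\mathbb{Z}^2$ with $\|u\|_\infty\ge n+f(n)$ belongs to $\Delta_X(p,q)$. *)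

theory Defs
  imports "HOL-Analysis.Analysis" "HOL-Library.Landau_Symbols"
    "HOL-Library.Countable" "HOL-Library.Nat_Bijection"
begin

section \<open>Computability\<close>

text \<open>
  \<open>recursive n f\<close>: \<open>f\<close> is a total \<open>n\<close>-ary recursive function on the natural numbers, its
  arguments being given as a list of length \<open>n\<close>; the values of \<open>f\<close> on lists of other lengths are
  irrelevant. This is the usual class obtained from the initial functions by composition,
  primitive recursion and minimisation of regular functions, i.e. minimisation is only
  applied when it is everywhere defined. By Kleene's normal form theorem these are exactly the
  total functions that are partial recursive.
\<close>

inductive recursive :: "nat \<Rightarrow> (nat list \<Rightarrow> nat) \<Rightarrow> bool" where
  zero: "recursive n (\<lambda>xs. 0)"
| succ: "recursive 1 (\<lambda>xs. Suc (xs ! 0))"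
| proj: "i < n \<Longrightarrow> recursive n (\<lambda>xs. xs ! i)"
| comp: "recursive (length gs) h \<Longrightarrow> (\<forall>g\<in>set gs. recursive n g) \<Longrightarrow>
    recursive n (\<lambda>xs. h (map (\<lambda>g. g xs) gs))"
| prec: "recursive n g \<Longrightarrow> recursive (n + 2) h \<Longrightarrow>
    recursive (n + 1) (\<lambda>xs. rec_nat (g (tl xs)) (\<lambda>k r. h (k # r # tl xs)) (hd xs))"
| mu: "recursive (n + 1) g \<Longrightarrow> (\<forall>xs. length xs = n \<longrightarrow> (\<exists>y. g (y # xs) = 0)) \<Longrightarrow>
    recursive n (\<lambda>xs. LEAST y. g (y # xs) = 0)"

definition computable :: "(nat \<Rightarrow> nat) \<Rightarrow> bool" where
  "computable f \<longleftrightarrow> (\<exists>g. recursive 1 g \<and> (\<forall>n. g [n] = f n))"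


section \<open>Configurations, patterns and subshifts\<close>

text \<open>The alphabet is a finite type; a pattern is a partial map, its support being its domain.\<close>

type_synonym 'a config = "int \<times> int \<Rightarrow> 'a"
type_synonym 'a pattern = "int \<times> int \<rightharpoonup> 'a"

definition shift :: "int \<times> int \<Rightarrow> 'a config \<Rightarrow> 'a config" where
  "shift u x = (\<lambda>v. x (u + v))"

definition subshift :: "'a::finite config set \<Rightarrow> bool" where
  "subshift X \<longleftrightarrow>
     compactin (product_topology (\<lambda>_. discrete_topology UNIV) UNIV) X \<and>
     (\<forall>u. shift u ` X \<subseteq> X)"

definition occurs_at :: "'a pattern \<Rightarrow> int \<times> int \<Rightarrow> 'a config \<Rightarrow> bool" where
  "occurs_at p u x \<longleftrightarrow> (\<forall>v\<in>dom p. p v = Some (x (u + v)))"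

definition finite_type :: "'a::finite config set \<Rightarrow> bool" where
  "finite_type X \<longleftrightarrow>
     (\<exists>F :: 'a pattern set. finite F \<and> (\<forall>p\<in>F. finite (dom p)) \<and>
        X = {x. \<forall>p\<in>F. \<forall>u. \<not> occurs_at p u x})"

definition language :: "'a config set \<Rightarrow> 'a pattern set" where
  "language X = {p. finite (dom p) \<and> (\<exists>x\<in>X. \<exists>u. occurs_at p u x)}"

text \<open>
  A finite pattern is presented to an algorithm by any list of its (position, letter) pairs.
  Positions are coded by explicit computable bijections. For the letters \<open>to_nat\<close> is an
  unspecified injection, which is harmless because the alphabet is finite (any two injections
  differ by a finite table).
\<close>

definition pattern_code :: "((int \<times> int) \<times> 'a::finite) list \<Rightarrow> nat" where
  "pattern_code l = list_encode
     (map (\<lambda>((i, j), a). prod_encode (prod_encode (int_encode i, int_encode j), to_nat a)) l)"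

definition decidable :: "'a::finite pattern set \<Rightarrow> bool" where
  "decidable L \<longleftrightarrow>
     (\<exists>d. computable d \<and>
        (\<forall>l. distinct (map fst l) \<longrightarrow>
           d (pattern_code l) = (if map_of l \<in> L then 1 else 0)))"


section \<open>Block gluing\<close>

definition square :: "nat \<Rightarrow> (int \<times> int) set" where
  "square n = {0..<int n} \<times> {0..<int n}"

definition block :: "nat \<Rightarrow> 'a pattern \<Rightarrow> bool" where
  "block n p \<longleftrightarrow> dom p = square n"

definition sup_norm :: "int \<times> int \<Rightarrow> int" where
  "sup_norm u = max \<bar>fst u\<bar> \<bar>snd u\<bar>"

definition gluing_set :: "'a config set \<Rightarrow> 'a pattern \<Rightarrow> 'a pattern \<Rightarrow> (int \<times> int) set" where
  "gluing_set X p q = {u. \<exists>x\<in>X. occurs_at q 0 x \<and> occurs_at p u x}"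

definition block_gluing :: "(nat \<Rightarrow> nat) \<Rightarrow> 'a config set \<Rightarrow> bool" where
  "block_gluing f X \<longleftrightarrow>
     (\<forall>n p q. block n p \<and> block n q \<and> p \<in> language X \<and> q \<in> language X \<longrightarrow>
        (\<forall>u. sup_norm u \<ge> int (n + f n) \<longrightarrow> u \<in> gluing_set X p q))"

end

theory Submission imports Defs begin

text \<open>
  The complement of the language of a subshift of finite type is semi-decidable by compactness: a
  pattern outside the language has no locally admissible extension to some large square. It
  remains to semi-decide the language itself, for which it suffices that periodic configurations
  are dense, since these can be enumerated as locally admissible colourings of tori.

  Let \<open>p\<close> be an \<open>m\<close>-block of \<open>X\<close>. Gluing repeatedly doubles the number of copies of \<open>p\<close> on a
  horizontal line while the width at most triples (as \<open>f \<le> id\<close>), so some \<open>x \<in> X\<close> carries \<open>2 ^ k\<close>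
  copies of \<open>p\<close> in the strip \<open>T\<close> of height \<open>m\<close> and width \<open>n \<le> 3 ^ k * m\<close>. The \<open>n\<close>-block whose top
  rows are \<open>T\<close> can be glued below the \<open>n\<close>-block whose bottom rows are \<open>T\<close>, so \<open>T\<close> occurs twice in
  the same columns at vertical distance \<open>f n + m\<close>. The columns to the right of the left end of a
  copy, over a window width and this height, take at most
  \<open>CARD('a) ^ (r * (f n + 2 * m))\<close> values, which is less than \<open>2 ^ k\<close> for suitable \<open>k\<close> because
  \<open>f n \<in> o(log n)\<close>. Two copies of \<open>p\<close> with equal values bound a rectangle that closes up to a
  torus containing \<open>p\<close>.
\<close>

section \<open>Closure properties of recursive functions\<close>

text \<open>The closure operations of \<open>recursive\<close> fix the value of a function on lists of the wrong
  length as well; working up to agreement on lists of length \<open>n\<close> removes this dependence.\<close>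

definition recf :: "nat \<Rightarrow> (nat list \<Rightarrow> nat) \<Rightarrow> bool" where
  "recf n f \<longleftrightarrow> (\<exists>g. recursive n g \<and> (\<forall>xs. length xs = n \<longrightarrow> g xs = f xs))"

definition recp :: "nat \<Rightarrow> (nat list \<Rightarrow> bool) \<Rightarrow> bool" where
  "recp n P \<longleftrightarrow> recf n (\<lambda>xs. of_bool (P xs))"

lemma recf_cong:
  assumes "recf n f" "\<And>xs. length xs = n \<Longrightarrow> f xs = g xs"
  shows "recf n g"
  using assms unfolding recf_def by metis

lemma recp_cong:
  assumes "recp n P" "\<And>xs. length xs = n \<Longrightarrow> P xs \<longleftrightarrow> Q xs"
  shows "recp n Q"
  using assms unfolding recp_def by (auto elim: recf_cong)

lemma recf_comp:
  assumes "recf (length gs) h" "\<And>g. g \<in> set gs \<Longrightarrow> recf n g"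
  shows "recf n (\<lambda>xs. h (map (\<lambda>g. g xs) gs))"
proof -
  obtain h' where h': "recursive (length gs) h'" "\<And>xs. length xs = length gs \<Longrightarrow> h' xs = h xs"
    using assms(1) unfolding recf_def by auto
  have "\<forall>g\<in>set gs. \<exists>g'. recursive n g' \<and> (\<forall>xs. length xs = n \<longrightarrow> g' xs = g xs)"
    using assms(2) unfolding recf_def by auto
  then obtain c where c: "\<And>g. g \<in> set gs \<Longrightarrow> recursive n (c g)"
      "\<And>g xs. g \<in> set gs \<Longrightarrow> length xs = n \<Longrightarrow> c g xs = g xs"
    by metis
  have "recursive n (\<lambda>xs. h' (map (\<lambda>g. g xs) (map c gs)))"
    by (rule recursive.comp) (use h' c in auto)
  moreover have "h' (map (\<lambda>g. g xs) (map c gs)) = h (map (\<lambda>g. g xs) gs)" if "length xs = n" for xs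
  proof -
    have "map (\<lambda>g. g xs) (map c gs) = map (\<lambda>g. g xs) gs"
      using c that by simp
    then show ?thesis using h'(2)[of "map (\<lambda>g. g xs) gs"] by (simp only: length_map)
  qed
  ultimately show ?thesis unfolding recf_def by blast
qed

lemma recf_nth: "i < n \<Longrightarrow> recf n (\<lambda>xs. xs ! i)"
  unfolding recf_def by (blast intro: recursive.proj)

lemma recf_hd: "recf (Suc n) hd"
  by (rule recf_cong[OF recf_nth[of 0]]) (auto simp: hd_conv_nth length_Suc_conv)

lemma map_nth_upt_drop:
  "length xs = k + n \<Longrightarrow> map (\<lambda>g. g xs) (map (\<lambda>i xs. xs ! (k + i)) [0..<n]) = drop k xs"
  by (auto intro!: nth_equalityI)

lemma recf_drop:
  assumes "recf n f"
  shows "recf (k + n) (\<lambda>xs. f (drop k xs))"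
proof -
  let ?gs = "map (\<lambda>i xs. xs ! (k + i)) [0..<n]"
  have "recf (k + n) (\<lambda>xs. f (map (\<lambda>g. g xs) ?gs))"
    by (rule recf_comp) (use assms in \<open>auto intro!: recf_nth\<close>)
  then show ?thesis
    by (rule recf_cong) (simp only: map_nth_upt_drop)
qed

lemma recf_tl: "recf n f \<Longrightarrow> recf (Suc n) (\<lambda>xs. f (tl xs))"
  using recf_drop[of n f 1] by (simp add: drop_Suc)

text \<open>Variables are handled as in de Bruijn notation: a bound variable is the head of the
  argument list and the parameters are its tail. Substitution replaces the head by a computed
  value.\<close>

lemma recf_subst:
  assumes "recf (Suc n) (\<lambda>ys. F (hd ys) (tl ys))" "recf n t"
  shows "recf n (\<lambda>xs. F (t xs) xs)"
proof -
  let ?gs = "t # map (\<lambda>i xs. xs ! (0 + i)) [0..<n]"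
  have "recf n (\<lambda>xs. (\<lambda>ys. F (hd ys) (tl ys)) (map (\<lambda>g. g xs) ?gs))"
    by (rule recf_comp) (use assms in \<open>auto intro!: recf_nth\<close>)
  then show ?thesis
    by (rule recf_cong) (simp only: list.map list.sel
        map_nth_upt_drop[of _ 0 n, unfolded add_0 drop_0] add_0)
qed

lemma recp_subst:
  assumes "recp (Suc n) (\<lambda>ys. P (hd ys) (tl ys))" "recf n t"
  shows "recp n (\<lambda>xs. P (t xs) xs)"
  using recf_subst[of n "\<lambda>a xs. of_bool (P a xs)" t] assms by (simp add: recp_def)

section \<open>Recursion, minimisation and basic arithmetic\<close>

lemma recf_0: "recf n (\<lambda>xs. 0)"
  unfolding recf_def by (blast intro: recursive.zero)

lemma recf_Suc:
  assumes "recf n f"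
  shows "recf n (\<lambda>xs. Suc (f xs))"
proof -
  have "recf n (\<lambda>xs. (\<lambda>ys. Suc (ys ! 0)) (map (\<lambda>g. g xs) [f]))"
    by (rule recf_comp) (use assms recursive.succ in \<open>auto simp: recf_def\<close>)
  then show ?thesis by simp
qed

lemma recf_const: "recf n (\<lambda>xs. c)"
  by (induction c) (auto intro: recf_0 recf_Suc)

lemma recf_rec:
  assumes "recf n t" "recf n g" "recf (Suc (Suc n)) (\<lambda>ys. h (hd ys) (hd (tl ys)) (tl (tl ys)))"
  shows "recf n (\<lambda>xs. rec_nat (g xs) (\<lambda>k r. h k r xs) (t xs))"
proof -
  obtain g' where g': "recursive n g'" "\<And>xs. length xs = n \<Longrightarrow> g' xs = g xs"
    using assms(2) unfolding recf_def by auto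
  obtain h' where h': "recursive (n + 2) h'"
      "\<And>ys. length ys = n + 2 \<Longrightarrow> h' ys = h (hd ys) (hd (tl ys)) (tl (tl ys))"
    using assms(3) unfolding recf_def by auto
  let ?R = "\<lambda>xs. rec_nat (g (tl xs)) (\<lambda>k r. h k r (tl xs)) (hd xs)"
  have "rec_nat (g' (tl xs)) (\<lambda>k r. h' (k # r # tl xs)) (hd xs) = ?R xs" if "length xs = n + 1" for xs
  proof -
    have "(\<lambda>k r. h' (k # r # tl xs)) = (\<lambda>k r. h k r (tl xs))"
      using h'(2) that by (intro ext) simp
    then show ?thesis using g' that by simp
  qed
  then have "recf (Suc n) ?R"
    using recursive.prec[OF g'(1) h'(1)] unfolding recf_def by auto
  from recf_subst[where F = "\<lambda>k xs. rec_nat (g xs) (\<lambda>k r. h k r xs) k", OF this assms(1)]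
  show ?thesis .
qed

lemma recf_Least:
  assumes "recp (Suc n) (\<lambda>ys. P (hd ys) (tl ys))" "\<And>xs. length xs = n \<Longrightarrow> \<exists>y. P y xs"
  shows "recf n (\<lambda>xs. LEAST y. P y xs)"
proof -
  \<comment> \<open>\<open>recursive.mu\<close> searches for a zero, so the truth value is inverted:
    \<open>?N\<close> is 0 where \<open>P\<close> holds and 1 elsewhere.\<close>
  let ?N = "\<lambda>ys. rec_nat 1 (\<lambda>k r. 0) (of_bool (P (hd ys) (tl ys)))"
  have "recf (Suc n) ?N"
    by (rule recf_rec[where g = "\<lambda>_. 1" and h = "\<lambda>_ _ _. 0"])
       (use assms(1) in \<open>auto simp: recp_def intro: recf_const\<close>)
  then obtain g where g: "recursive (n + 1) g" "\<And>ys. length ys = Suc n \<Longrightarrow> g ys = ?N ys"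
    unfolding recf_def by auto
  have eq: "g (y # xs) = 0 \<longleftrightarrow> P y xs" if "length xs = n" for y xs
    using g(2)[of "y # xs"] that by auto
  have "recursive n (\<lambda>xs. LEAST y. g (y # xs) = 0)"
    by (rule recursive.mu[OF g(1)]) (use eq assms(2) in auto)
  then show ?thesis unfolding recf_def using eq by auto
qed

lemma recf_pred:
  assumes "recf n f"
  shows "recf n (\<lambda>xs. f xs - 1)"
proof -
  have "recf n (\<lambda>xs. rec_nat 0 (\<lambda>k r. k) (f xs))"
    by (rule recf_rec[where h = "\<lambda>k r xs. k"]) (intro assms recf_0 recf_hd)+
  moreover have "rec_nat 0 (\<lambda>k r. k) m = m - 1" for m :: nat
    by (cases m) auto
  ultimately show ?thesis by simp
qed

lemma recf_add:
  assumes "recf n f" "recf n g"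
  shows "recf n (\<lambda>xs. f xs + g xs)"
proof -
  have "recf n (\<lambda>xs. rec_nat (f xs) (\<lambda>k r. Suc r) (g xs))"
    by (rule recf_rec[where h = "\<lambda>k r xs. Suc r"]) (intro assms recf_Suc recf_tl recf_hd)+
  moreover have "rec_nat a (\<lambda>k r. Suc r) m = a + m" for a m :: nat
    by (induction m) auto
  ultimately show ?thesis by simp
qed

lemma recf_diff:
  assumes "recf n f" "recf n g"
  shows "recf n (\<lambda>xs. f xs - g xs)"
proof -
  have "recf n (\<lambda>xs. rec_nat (f xs) (\<lambda>k r. r - 1) (g xs))"
    by (rule recf_rec[where h = "\<lambda>k r xs. r - 1"]) (intro assms recf_pred recf_tl recf_hd)+
  moreover have "rec_nat a (\<lambda>k r. r - 1) m = a - m" for a m :: nat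
    by (induction m) auto
  ultimately show ?thesis by simp
qed

lemma recf_mult:
  assumes "recf n f" "recf n g"
  shows "recf n (\<lambda>xs. f xs * g xs)"
proof -
  have "recf n (\<lambda>xs. rec_nat 0 (\<lambda>k r. r + f xs) (g xs))"
    by (rule recf_rec[where h = "\<lambda>k r xs. r + f xs"])
       (intro assms recf_0 recf_add recf_tl[where f = hd] recf_hd
         recf_tl[where f = "\<lambda>zs. f (tl zs)"] recf_tl[where f = f])+
  moreover have "rec_nat 0 (\<lambda>k r. r + a) m = a * m" for a m :: nat
    by (induction m) auto
  ultimately show ?thesis by simp
qed

lemma recf_power:
  assumes "recf n f" "recf n g"
  shows "recf n (\<lambda>xs. f xs ^ g xs)"
proof -
  have "recf n (\<lambda>xs. rec_nat 1 (\<lambda>k r. r * f xs) (g xs))"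
    by (rule recf_rec[where h = "\<lambda>k r xs. r * f xs"])
       (intro assms recf_const recf_mult recf_tl[where f = hd] recf_hd
         recf_tl[where f = "\<lambda>zs. f (tl zs)"] recf_tl[where f = f])+
  moreover have "rec_nat 1 (\<lambda>k r. r * a) m = a ^ m" for a m :: nat
    by (induction m) auto
  ultimately show ?thesis by simp
qed

section \<open>Recursive predicates and bounded quantifiers\<close>

lemma recp_not:
  assumes "recp n P"
  shows "recp n (\<lambda>xs. \<not> P xs)"
proof -
  have "recf n (\<lambda>xs. 1 - of_bool (P xs))"
    by (intro recf_diff recf_const assms[unfolded recp_def])
  then show ?thesis unfolding recp_def by (rule recf_cong) auto
qed

lemma recp_conj:
  assumes "recp n P" "recp n Q"
  shows "recp n (\<lambda>xs. P xs \<and> Q xs)"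
proof -
  have "recf n (\<lambda>xs. of_bool (P xs) * of_bool (Q xs))"
    by (intro recf_mult assms[unfolded recp_def])
  then show ?thesis unfolding recp_def by (rule recf_cong) auto
qed

lemma recp_disj:
  assumes "recp n P" "recp n Q"
  shows "recp n (\<lambda>xs. P xs \<or> Q xs)"
  using recp_not[OF recp_conj[OF recp_not recp_not, OF assms]] by simp

lemma recp_const: "recp n (\<lambda>xs. c)"
  unfolding recp_def by (rule recf_const)

lemma recp_less:
  assumes "recf n f" "recf n g"
  shows "recp n (\<lambda>xs. f xs < g xs)"
proof -
  have "recf n (\<lambda>xs. 1 - (1 - (g xs - f xs)))"
    by (intro recf_diff recf_const assms)
  then show ?thesis unfolding recp_def by (rule recf_cong) auto
qed

lemma recp_le:
  assumes "recf n f" "recf n g"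
  shows "recp n (\<lambda>xs. f xs \<le> g xs)"
  using recp_not[OF recp_less[OF assms(2,1)]] by (simp add: not_less)

lemma recp_eq:
  assumes "recf n f" "recf n g"
  shows "recp n (\<lambda>xs. f xs = g xs)"
proof -
  have "recp n (\<lambda>xs. \<not> f xs < g xs \<and> \<not> g xs < f xs)"
    by (intro recp_conj recp_not recp_less assms)
  then show ?thesis by (rule recp_cong) auto
qed

lemma recf_If:
  assumes "recp n P" "recf n f" "recf n g"
  shows "recf n (\<lambda>xs. if P xs then f xs else g xs)"
proof -
  have "recf n (\<lambda>xs. of_bool (P xs) * f xs + of_bool (\<not> P xs) * g xs)"
    using assms recp_not[OF assms(1)] by (intro recf_add recf_mult) (auto simp: recp_def)
  then show ?thesis by (rule recf_cong) auto
qed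

lemma recp_finite_Bex:
  assumes "finite S" "\<And>s. s \<in> S \<Longrightarrow> recp n (P s)"
  shows "recp n (\<lambda>xs. \<exists>s\<in>S. P s xs)"
  using assms by (induction S) (auto intro: recp_const recp_disj)

lemma recp_finite_Ball:
  assumes "finite S" "\<And>s. s \<in> S \<Longrightarrow> recp n (P s)"
  shows "recp n (\<lambda>xs. \<forall>s\<in>S. P s xs)"
  using assms by (induction S) (auto intro: recp_const recp_conj)

text \<open>The dummy second argument makes room for the accumulator of a recursion or for a further
  bound variable.\<close>

lemma recf_skip:
  assumes "recf (Suc n) (\<lambda>ys. F (hd ys) (tl ys))"
  shows "recf (Suc (Suc n)) (\<lambda>ys. F (hd ys) (tl (tl ys)))"
proof -
  let ?gs = "hd # map (\<lambda>i xs. xs ! (2 + i)) [0..<n]"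
  have "recf (Suc (Suc n)) (\<lambda>xs. (\<lambda>ys. F (hd ys) (tl ys)) (map (\<lambda>g. g xs) ?gs))"
    by (rule recf_comp) (use assms in \<open>auto intro!: recf_nth recf_hd\<close>)
  then show ?thesis
    by (rule recf_cong)
       (simp only: list.map list.sel map_nth_upt_drop, simp add: drop_Suc numeral_2_eq_2)
qed

text \<open>Recursion on the bound, the accumulator remembering whether a witness has been seen; an
  unbounded search would not terminate when there is none.\<close>

lemma recp_bounded_ex:
  assumes "recf n t" "recp (Suc n) (\<lambda>ys. P (hd ys) (tl ys))"
  shows "recp n (\<lambda>xs. \<exists>y<t xs. P y xs)"
proof -
  let ?h = "\<lambda>k r xs. of_bool (r \<noteq> 0 \<or> P k xs) :: nat"
  have "recp (Suc (Suc n)) (\<lambda>ys. P (hd ys) (tl (tl ys)))"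
    using recf_skip[of n "\<lambda>a xs. of_bool (P a xs)"] assms(2) by (simp add: recp_def)
  then have "recp (Suc (Suc n)) (\<lambda>ys. hd (tl ys) \<noteq> 0 \<or> P (hd ys) (tl (tl ys)))"
    by (intro recp_disj recp_not recp_eq recf_const recf_tl recf_hd)
  then have "recf n (\<lambda>xs. rec_nat 0 (\<lambda>k r. ?h k r xs) (t xs))"
    by (intro recf_rec[where h = ?h] assms recf_const) (simp add: recp_def)
  moreover have "rec_nat 0 (\<lambda>k r. ?h k r xs) m = of_bool (\<exists>y<m. P y xs)" for m xs
    by (induction m) (auto simp: less_Suc_eq)
  ultimately show ?thesis by (simp add: recp_def)
qed

lemma recp_bounded_all:
  assumes "recf n t" "recp (Suc n) (\<lambda>ys. P (hd ys) (tl ys))"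
  shows "recp n (\<lambda>xs. \<forall>y<t xs. P y xs)"
  using recp_not[OF recp_bounded_ex[where P = "\<lambda>y xs. \<not> P y xs", OF assms(1) recp_not[OF assms(2)]]]
  by simp

section \<open>Division and pairing\<close>

lemma Least_eq_le: "(LEAST q. n \<le> q) = (n :: nat)"
  by (rule Least_equality) auto

lemma recf_div:
  assumes "recf n f" "recf n g"
  shows "recf n (\<lambda>xs. f xs div g xs)"
proof -
  \<comment> \<open>The quotient is the least \<open>q\<close> with \<open>x < Suc q * y\<close>.
    The disjunct \<open>y = 0\<close> keeps the search total and returns 0, the value of
    \<open>x div 0\<close>.\<close>
  have ex: "y = 0 \<or> x < Suc q * y \<longleftrightarrow> x div y \<le> q" for x y q :: nat
    by (cases "y = 0") (auto simp: less_Suc_eq_le[symmetric] div_less_iff_less_mult)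
  have "recf n (\<lambda>xs. LEAST q. g xs = 0 \<or> f xs < Suc q * g xs)"
    by (intro recf_Least recp_disj recp_eq recp_less recf_mult recf_Suc recf_hd recf_const
        recf_tl assms)
       (use ex in blast)
  then show ?thesis
    unfolding ex by (simp only: Least_eq_le)
qed

lemma recf_mod:
  assumes "recf n f" "recf n g"
  shows "recf n (\<lambda>xs. f xs mod g xs)"
proof -
  have "recf n (\<lambda>xs. f xs - f xs div g xs * g xs)"
    by (intro recf_diff recf_mult recf_div assms)
  then show ?thesis by (simp add: minus_div_mult_eq_mod)
qed

lemma recf_prod_encode:
  assumes "recf n f" "recf n g"
  shows "recf n (\<lambda>xs. prod_encode (f xs, g xs))"
  unfolding prod_encode_def triangle_def split
  by (intro recf_add recf_div recf_mult recf_Suc recf_const assms)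

lemma recf_fst_prod_decode:
  assumes "recf n f"
  shows "recf n (\<lambda>xs. fst (prod_decode (f xs)))"
proof -
  \<comment> \<open>Both components of a pair are at most its code, so the other component is
    searched only up to \<open>z\<close>.\<close>
  have eq: "(\<exists>b<Suc z. prod_encode (a, b) = z) \<longleftrightarrow> a = fst (prod_decode z)" for a z
    by (metis fst_conv le_prod_encode_2 less_Suc_eq_le prod.collapse prod_decode_inverse
        prod_encode_inverse)
  have "recf n (\<lambda>xs. LEAST a. \<exists>b<Suc (f xs). prod_encode (a, b) = f xs)"
    by (intro recf_Least recp_bounded_ex recp_eq recf_prod_encode recf_Suc recf_hd
        recf_tl[where f = hd] recf_tl[where f = "\<lambda>zs. f (tl zs)"] recf_tl[where f = f] assms)
       (use eq in blast)
  then show ?thesis by (simp add: eq Least_equality)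
qed

lemma recf_snd_prod_decode:
  assumes "recf n f"
  shows "recf n (\<lambda>xs. snd (prod_decode (f xs)))"
proof -
  have eq: "(\<exists>a<Suc z. prod_encode (a, b) = z) \<longleftrightarrow> b = snd (prod_decode z)" for b z
    by (metis snd_conv le_prod_encode_1 less_Suc_eq_le prod.collapse prod_decode_inverse
        prod_encode_inverse)
  have "recf n (\<lambda>xs. LEAST b. \<exists>a<Suc (f xs). prod_encode (a, b) = f xs)"
    by (intro recf_Least recp_bounded_ex recp_eq recf_prod_encode recf_Suc recf_hd
        recf_tl[where f = hd] recf_tl[where f = "\<lambda>zs. f (tl zs)"] recf_tl[where f = f] assms)
       (use eq in blast)
  then show ?thesis by (simp add: eq Least_equality)
qed

lemma computable_if_recf:
  assumes "recf 1 (\<lambda>xs. g (xs ! 0))"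
  shows "computable g"
  using assms unfolding recf_def computable_def
  by (metis One_nat_def length_Cons list.size(3) nth_Cons_0)

text \<open>Dropping \<open>k\<close> entries from a coded list amounts to \<open>k\<close> times taking the second component;
  this avoids coding course-of-values recursion.\<close>

definition code_drop :: "nat \<Rightarrow> nat \<Rightarrow> nat" where
  "code_drop k w = rec_nat w (\<lambda>_ r. snd (prod_decode (r - 1))) k"

lemma code_drop_eq: "code_drop k w = list_encode (drop k (list_decode w))"
proof (induction k)
  case (Suc k)
  \<comment> \<open>A nonempty list has code \<open>Suc (prod_encode (head, tail))\<close>, hence
    the \<open>- 1\<close>. For the empty list \<open>0 - 1 = 0\<close>, and since 0 decodes to
    \<open>(0, 0)\<close> the result is again its code 0.\<close>
  have "prod_decode 0 = (0, 0)"
    using prod_encode_inverse[of "(0, 0)"] by (simp add: prod_encode_def)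
  then have *: "snd (prod_decode (list_encode l - 1)) = list_encode (tl l)" for l
    by (cases l) simp_all
  have "code_drop (Suc k) w = snd (prod_decode (code_drop k w - 1))"
    by (simp add: code_drop_def)
  also have "\<dots> = list_encode (tl (drop k (list_decode w)))"
    by (simp only: Suc *)
  also have "tl (drop k (list_decode w)) = drop (Suc k) (list_decode w)"
    by (simp only: drop_Suc tl_drop)
  finally show ?case .
qed (simp add: code_drop_def)

lemma list_encode_bounds:
  "length l \<le> list_encode l" "t \<in> set l \<Longrightarrow> t < list_encode l"
proof (induction l)
  case (Cons a l)
  have "a \<le> prod_encode (a, list_encode l)" "list_encode l \<le> prod_encode (a, list_encode l)"
    by (rule le_prod_encode_1 le_prod_encode_2)+
  moreover
  case 1
  ultimately show ?case using Cons(1) by simp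
  case 2
  then show ?case using Cons(2) \<open>a \<le> _\<close> \<open>list_encode l \<le> prod_encode (a, _)\<close> by auto
qed auto

text \<open>The length of a list is at most its code, so \<open>k < w\<close> reaches every entry;
  past the end the remaining code is 0.\<close>

lemma Ball_set_list_decode:
  "(\<forall>t\<in>set (list_decode w). Q t) \<longleftrightarrow>
   (\<forall>k<w. code_drop k w = 0 \<or> Q (fst (prod_decode (code_drop k w - 1))))"
proof -
  let ?l = "list_decode w"
  have len: "length ?l \<le> w"
    using list_encode_bounds(1)[of ?l] by simp
  have 1: "code_drop k w \<noteq> 0 \<and> fst (prod_decode (code_drop k w - 1)) = ?l ! k" if "k < length ?l" for k
    using that by (simp add: code_drop_eq Cons_nth_drop_Suc[symmetric])
  have 2: "code_drop k w = 0" if "k \<ge> length ?l" for k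
    using that by (simp add: code_drop_eq)
  show ?thesis
  proof
    assume "\<forall>t\<in>set ?l. Q t"
    then show "\<forall>k<w. code_drop k w = 0 \<or> Q (fst (prod_decode (code_drop k w - 1)))"
      using 1 2 by (metis leI nth_mem)
  next
    assume *: "\<forall>k<w. code_drop k w = 0 \<or> Q (fst (prod_decode (code_drop k w - 1)))"
    show "\<forall>t\<in>set ?l. Q t"
    proof
      fix t assume "t \<in> set ?l"
      then obtain k where "k < length ?l" "t = ?l ! k" by (auto simp: in_set_conv_nth)
      then show "Q t" using *[rule_format, of k] 1[of k] len by simp
    qed
  qed
qed

lemma recp_Ball_set_list_decode:
  assumes "recf n w" "recp (Suc n) (\<lambda>ys. Q (hd ys) (tl ys))"
  shows "recp n (\<lambda>xs. \<forall>t\<in>set (list_decode (w xs)). Q t xs)"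
proof -
  have d: "recf n (\<lambda>xs. code_drop (k xs) (v xs))" if "recf n k" "recf n v" for n k v
    unfolding code_drop_def
    by (rule recf_rec[where h = "\<lambda>k r xs. snd (prod_decode (r - 1))"])
       (intro that recf_snd_prod_decode recf_pred recf_tl recf_hd)+
  let ?t = "\<lambda>ys. fst (prod_decode (code_drop (hd ys) (w (tl ys)) - 1))"
  have t: "recf (Suc n) ?t"
    by (intro recf_fst_prod_decode recf_pred d recf_hd recf_tl assms)
  have Q: "recp (Suc n) (\<lambda>ys. Q (?t ys) (tl ys))"
    by (rule recp_subst[where P = "\<lambda>a ys. Q a (tl ys)" and t = ?t])
       (use t assms(2) recf_skip[of n "\<lambda>a xs. of_bool (Q a xs)"] in \<open>auto simp: recp_def\<close>)
  show ?thesis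
    unfolding Ball_set_list_decode
    by (intro recp_bounded_all recp_disj recp_eq recf_const d recf_hd recf_tl Q assms)
qed

text \<open>An even \<open>d\<close> decodes to \<open>d div 2\<close>, an odd one to
  \<open>- (d div 2) - 1\<close>, and \<open>- a - 1\<close> has residue
  \<open>M - 1 - a mod M\<close>. Coded integer coordinates are thus reduced modulo the side of a
  torus within the natural numbers.\<close>

lemma recf_int_decode_mod:
  assumes "recf n f" "recf n g" "\<And>xs. length xs = n \<Longrightarrow> 0 < g xs"
  shows "recf n (\<lambda>xs. nat (int_decode (f xs) mod int (g xs)))"
proof -
  have eq: "nat (int_decode d mod int M) =
      (if d mod 2 = 0 then d div 2 mod M else M - 1 - d div 2 mod M)" if "0 < M" for d M
  proof (cases "d mod 2 = 0")
    case True
    then show ?thesis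
      by (simp add: int_decode_def sum_decode_def even_iff_mod_2_eq_zero nat_mod_distrib)
  next
    case False
    then have "int_decode d = - int (d div 2) - 1"
      by (simp add: int_decode_def sum_decode_def even_iff_mod_2_eq_zero)
    moreover have "(- int a - 1) mod int M = int (M - 1 - a mod M)" for a
    proof -
      have "int M * (- int (a div M) - 1) + int (M - 1 - a mod M) = - int a - 1"
      proof -
        have "a mod M < M" using that by simp
        moreover have "int a = int M * int (a div M) + int (a mod M)"
          by (metis mult_div_mod_eq of_nat_add of_nat_mult)
        ultimately show ?thesis by (simp add: of_nat_diff algebra_simps)
      qed
      then show ?thesis
        using that by (intro int_mod_pos_eq[where q = "- int (a div M) - 1"]) auto
    qed
    ultimately show ?thesis using False by simp
  qed
  have "recf n (\<lambda>xs. if f xs mod 2 = 0 then f xs div 2 mod g xs else g xs - 1 - f xs div 2 mod g xs)"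
    by (intro recf_If recp_eq recf_mod recf_div recf_diff recf_const assms)
  then show ?thesis
    by (rule recf_cong) (simp add: eq assms(3))
qed


section \<open>Block gluing subshifts of finite type\<close>

lemma occurs_at_shift: "occurs_at p u (shift w x) \<longleftrightarrow> occurs_at p (w + u) x"
  by (simp add: occurs_at_def shift_def add.assoc)

lemma occurs_at_translate: "occurs_at (\<lambda>v. q (v - w)) u x \<longleftrightarrow> occurs_at q (u + w) x"
proof
  assume *: "occurs_at (\<lambda>v. q (v - w)) u x"
  show "occurs_at q (u + w) x"
    unfolding occurs_at_def
  proof
    fix v assume "v \<in> dom q"
    then have "v + w \<in> dom (\<lambda>v. q (v - w))" by (auto simp: dom_def)
    with * have "q (v + w - w) = Some (x (u + (v + w)))" unfolding occurs_at_def by blast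
    then show "q v = Some (x (u + w + v))" by (simp add: algebra_simps)
  qed
next
  assume *: "occurs_at q (u + w) x"
  show "occurs_at (\<lambda>v. q (v - w)) u x"
    unfolding occurs_at_def
  proof
    fix v assume "v \<in> dom (\<lambda>v. q (v - w))"
    then have "v - w \<in> dom q" by (auto simp: dom_def)
    with * have "q (v - w) = Some (x (u + w + (v - w)))" unfolding occurs_at_def by blast
    then show "q (v - w) = Some (x (u + v))" by (simp add: algebra_simps)
  qed
qed

lemma occurs_at_cong:
  assumes "dom q \<subseteq> D" "\<And>v. v \<in> D \<Longrightarrow> x (u + v) = y (u' + v)"
  shows "occurs_at q u x \<longleftrightarrow> occurs_at q u' y"
  using assms unfolding occurs_at_def by (metis subsetD)

lemma subshift_shift: "subshift X \<Longrightarrow> x \<in> X \<Longrightarrow> shift u x \<in> X"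
  unfolding subshift_def by blast

definition avoiding :: "'a pattern set \<Rightarrow> 'a config set" where
  "avoiding F = {x. \<forall>q\<in>F. \<forall>u. \<not> occurs_at q u x}"

text \<open>All translates of a forbidden pattern are forbidden, so translating the patterns by
  \<open>(R, R)\<close>, with \<open>R\<close> bounding all coordinates, puts their supports into
  one square.\<close>

lemma finite_type_windowE:
  assumes "finite_type X"
  obtains F r where "finite F" "\<And>q. q \<in> F \<Longrightarrow> dom q \<subseteq> square r" "X = avoiding F"
proof -
  obtain G where G: "finite G" "\<And>p. p \<in> G \<Longrightarrow> finite (dom p)" "X = avoiding G"
    using assms unfolding finite_type_def avoiding_def by blast
  let ?D = "\<Union> (dom ` G)"
  have fin: "finite ?D" using G by blast
  define R where "R = (\<Sum>v\<in>?D. nat \<bar>fst v\<bar> + nat \<bar>snd v\<bar>)"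
  have R: "\<bar>fst v\<bar> \<le> int R \<and> \<bar>snd v\<bar> \<le> int R" if "v \<in> ?D" for v
  proof -
    have "nat \<bar>fst v\<bar> + nat \<bar>snd v\<bar> \<le> R"
      unfolding R_def using fin that by (intro member_le_sum) auto
    then show ?thesis by linarith
  qed
  let ?w = "(int R, int R)"
  let ?F = "(\<lambda>q v. q (v - ?w)) ` G"
  have "finite ?F" using G by blast
  moreover have "dom q \<subseteq> square (2 * R + 1)" if "q \<in> ?F" for q
  proof
    fix v assume v: "v \<in> dom q"
    from that obtain p where p: "p \<in> G" "q = (\<lambda>v. p (v - ?w))" by blast
    with v have "v - ?w \<in> dom p" by (auto simp: dom_def)
    then have "v - ?w \<in> ?D" using p by blast
    from R[OF this] show "v \<in> square (2 * R + 1)"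
      by (cases v) (auto simp: square_def)
  qed
  moreover have "X = avoiding ?F"
  proof -
    have "(\<forall>u. \<not> occurs_at q (u + ?w) x) \<longleftrightarrow> (\<forall>u. \<not> occurs_at q u x)" for q :: "'a pattern" and x
      by (metis diff_add_cancel)
    then show ?thesis
      using G(3) by (simp add: avoiding_def occurs_at_translate)
  qed
  ultimately show ?thesis using that by blast
qed

section \<open>Repeated copies of a block obtained by gluing\<close>

lemma block_gluing_glue:
  assumes "block_gluing f X" "x \<in> X" "y \<in> X" "int (n + f n) \<le> sup_norm u"
  shows "\<exists>z\<in>X. \<forall>v\<in>square n. z v = x v \<and> z (u + v) = y v"
proof -
  let ?p = "\<lambda>x :: 'a config. (\<lambda>v. Some (x v)) |` square n"
  have blk: "block n (?p x)" for x
    by (auto simp: block_def)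
  have occ: "occurs_at (?p x) u z \<longleftrightarrow> (\<forall>v\<in>square n. z (u + v) = x v)" for x u z
    by (auto simp: occurs_at_def)
  have lang: "?p x \<in> language X" if "x \<in> X" for x
  proof -
    have "occurs_at (?p x) 0 x" by (simp add: occ)
    moreover have "finite (dom (?p x))" by (simp add: square_def)
    ultimately show ?thesis using that unfolding language_def by blast
  qed
  have "u \<in> gluing_set X (?p y) (?p x)"
    using assms blk lang unfolding block_gluing_def by blast
  then obtain z where "z \<in> X" "occurs_at (?p x) 0 z" "occurs_at (?p y) u z"
    unfolding gluing_set_def by blast
  then show ?thesis unfolding occ by (intro bexI[of _ z]) auto
qed

text \<open>Gluing \<open>z\<close> to itself at horizontal distance \<open>n + f n\<close> doubles
  the set \<open>S\<close> of left ends, and the new width \<open>2 * n + f n\<close> is at most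
  \<open>3 * n\<close>. The spacing \<open>m\<close> is carried through the induction because it
  later bounds the horizontal period from below.\<close>

lemma block_gluing_copies:
  fixes x :: "'a::finite config"
  assumes bg: "block_gluing f X" and f: "\<And>n. f n \<le> n" and x: "x \<in> X" and m: "0 < m"
  shows "\<exists>n S z. z \<in> X \<and> m \<le> n \<and> n \<le> 3 ^ k * m \<and> finite S \<and> card S = 2 ^ k \<and>
     (\<forall>s\<in>S. 0 \<le> s \<and> s + int m \<le> int n \<and> (\<forall>v\<in>square m. z ((s, 0) + v) = x v)) \<and>
     (\<forall>s\<in>S. \<forall>t\<in>S. s < t \<longrightarrow> s + int m \<le> t)"
proof (induction k)
  case 0
  have "(0, 0) + v = v" for v :: "int \<times> int" by (cases v) simp
  then show ?case
    using x by (intro exI[of _ m] exI[of _ "{0}"] exI[of _ x]) simp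
next
  case (Suc k)
  then obtain n S z where "z \<in> X \<and> m \<le> n \<and> n \<le> 3 ^ k * m \<and> finite S \<and> card S = 2 ^ k \<and>
     (\<forall>s\<in>S. 0 \<le> s \<and> s + int m \<le> int n \<and> (\<forall>v\<in>square m. z ((s, 0) + v) = x v)) \<and>
     (\<forall>s\<in>S. \<forall>t\<in>S. s < t \<longrightarrow> s + int m \<le> t)"
    by (elim exE)
  then have *: "z \<in> X" "m \<le> n" "n \<le> 3 ^ k * m" "finite S" "card S = 2 ^ k"
    "\<And>s. s \<in> S \<Longrightarrow> 0 \<le> s \<and> s + int m \<le> int n"
    "\<And>s v. s \<in> S \<Longrightarrow> v \<in> square m \<Longrightarrow> z ((s, 0) + v) = x v"
    "\<And>s t. s \<in> S \<Longrightarrow> t \<in> S \<Longrightarrow> s < t \<Longrightarrow> s + int m \<le> t"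
    by blast+
  define d where "d = int (n + f n)"
  have "int (n + f n) \<le> sup_norm (d, 0)" by (simp add: sup_norm_def d_def)
  from block_gluing_glue[OF bg *(1) *(1) this] obtain z'
    where z': "z' \<in> X" "\<And>v. v \<in> square n \<Longrightarrow> z' v = z v" "\<And>v. v \<in> square n \<Longrightarrow> z' ((d, 0) + v) = z v"
    by blast
  have sq: "(s, 0) + v \<in> square n" if "s \<in> S" "v \<in> square m" for s v
    using *(6)[OF that(1)] that(2) \<open>m \<le> n\<close> by (cases v) (auto simp: square_def)
  let ?S = "S \<union> (+) d ` S"
  \<comment> \<open>Left ends in \<open>S\<close> are at most \<open>n - m\<close>, hence smaller
    than \<open>d\<close> as \<open>m\<close> is positive; so the translated ones are new.\<close>
  have "s \<noteq> d + t" if "s \<in> S" "t \<in> S" for s t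
    using *(6)[OF that(1)] *(6)[OF that(2)] m by (simp add: d_def)
  then have "S \<inter> (+) d ` S = {}" by blast
  then have "card ?S = 2 ^ Suc k"
    using *(4,5) by (simp add: card_Un_disjoint card_image)
  moreover have "2 * n + f n \<le> 3 ^ Suc k * m" using *(3) f[of n] by simp
  moreover have "\<forall>v\<in>square m. z' ((s, 0) + v) = x v" if "s \<in> ?S" for s
    using that
  proof
    assume s: "s \<in> S"
    show ?thesis using z'(2)[OF sq[OF s]] *(7)[OF s] by simp
  next
    assume "s \<in> (+) d ` S"
    then obtain t where t: "t \<in> S" "s = d + t" by (rule imageE) auto
    then have "z' ((s, 0) + v) = z' ((d, 0) + ((t, 0) + v))" for v
      by (cases v) (simp add: add.assoc)
    then show ?thesis using z'(3)[OF sq[OF t(1)]] *(7)[OF t(1)] by simp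
  qed
  moreover have "\<forall>s\<in>?S. 0 \<le> s \<and> s + int m \<le> int (2 * n + f n)"
  proof
    fix s assume "s \<in> ?S"
    then show "0 \<le> s \<and> s + int m \<le> int (2 * n + f n)"
      using *(6)[of s] *(6)[of "s - d"] by (auto simp: d_def)
  qed
  moreover have "\<forall>s\<in>?S. \<forall>t\<in>?S. s < t \<longrightarrow> s + int m \<le> t"
  proof -
    have "s + int m \<le> d + t" if "s \<in> S" "t \<in> S" for s t
      using *(6)[OF that(1)] *(6)[OF that(2)] by (simp add: d_def)
    moreover have "\<not> d + s < t" if "s \<in> S" "t \<in> S" for s t
      using *(6)[OF that(1)] *(6)[OF that(2)] by (simp add: d_def)
    moreover have "d + s + int m \<le> d + t" if "s \<in> S" "t \<in> S" "d + s < d + t" for s t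
      using *(8)[OF that(1,2)] that(3) by simp
    ultimately show ?thesis using *(8) by blast
  qed
  ultimately show ?case
    using z'(1) *(2,4) by (intro exI[of _ "2 * n + f n"] exI[of _ ?S] exI[of _ z']) simp
qed

lemma block_gluing_strip:
  assumes bg: "block_gluing f X" and sub: "subshift X" and x: "x \<in> X" and "m \<le> n"
  shows "\<exists>y\<in>X. \<forall>i j. 0 \<le> i \<and> i < int n \<and> 0 \<le> j \<and> j < int m \<longrightarrow>
    y (i, j) = x (i, j) \<and> y (i, j + int (f n + m)) = x (i, j)"
proof -
  \<comment> \<open>The lower block must carry the strip in its top \<open>m\<close> rows, so
    \<open>x\<close> is moved up by \<open>c\<close>. The upper block starts at height
    \<open>n + f n\<close>; undoing the shift leaves the vertical distance
    \<open>n + f n - c = f n + m\<close>.\<close>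
  define c where "c = int n - int m"
  have "int (n + f n) \<le> sup_norm (0, int (n + f n))" by (simp add: sup_norm_def)
  from block_gluing_glue[OF bg subshift_shift[OF sub x, of "(0, - c)"] x this] obtain z
    where z: "z \<in> X" "\<And>v. v \<in> square n \<Longrightarrow> z v = shift (0, - c) x v"
      "\<And>v. v \<in> square n \<Longrightarrow> z ((0, int (n + f n)) + v) = x v" by blast
  have "shift (0, c) z (i, j) = x (i, j) \<and> shift (0, c) z (i, j + int (f n + m)) = x (i, j)"
    if "0 \<le> i" "i < int n" "0 \<le> j" "j < int m" for i j
  proof -
    have "(i, c + j) \<in> square n" "(i, j) \<in> square n"
      using that \<open>m \<le> n\<close> by (auto simp: square_def c_def)
    from z(2)[OF this(1)] z(3)[OF this(2)] show ?thesis
      by (simp add: shift_def c_def algebra_simps)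
  qed
  then show ?thesis using subshift_shift[OF sub z(1), of "(0, c)"] by blast
qed

text \<open>A window of the torus can be moved so that its corner lies in the fundamental rectangle
  of width \<open>P\<close> and height \<open>h\<close>. It then lies in this rectangle enlarged by
  \<open>r\<close>, where the torus coincides with \<open>y\<close>.\<close>

lemma avoiding_torus:
  assumes F: "\<And>q. q \<in> F \<Longrightarrow> dom q \<subseteq> square r" and y: "y \<in> avoiding F"
    and vert: "\<And>i j. 0 \<le> i \<Longrightarrow> i < P \<Longrightarrow> 0 \<le> j \<Longrightarrow> j < int r \<Longrightarrow> y (s + i, j + h) = y (s + i, j)"
    and hor: "\<And>i j. 0 \<le> i \<Longrightarrow> i < int r \<Longrightarrow> 0 \<le> j \<Longrightarrow> j < h + int r \<Longrightarrow> y (s + P + i, j) = y (s + i, j)"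
    and pos: "int r \<le> P" "0 < P" "int r \<le> h" "0 < h"
  shows "(\<lambda>(i, j). y (s + i mod P, j mod h)) \<in> avoiding F"
proof -
  let ?z = "\<lambda>(i, j). y (s + i mod P, j mod h)"
  \<comment> \<open>As \<open>r\<close> is at most \<open>P\<close> and \<open>h\<close>, at most
    one period is subtracted in each direction. The vertical step happens in the reduced column, the
    horizontal one at the unreduced row \<open>b\<close>, which is why \<open>hor\<close> covers
    \<open>h + r\<close> rows.\<close>
  have red: "y (s + a mod P, b mod h) = y (s + a, b)"
    if "0 \<le> a" "a < P + int r" "0 \<le> b" "b < h + int r" for a b
  proof -
    have "y (s + a mod P, b mod h) = y (s + a mod P, b)"
    proof (cases "b < h")
      case False
      then have "b mod h = b - h"
        using that pos by (intro int_mod_pos_eq[where q = 1]) auto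
      then show ?thesis
        using vert[of "a mod P" "b - h"] False that pos by simp
    qed (use that in simp)
    also have "\<dots> = y (s + a, b)"
    proof (cases "a < P")
      case False
      then have "a mod P = a - P"
        using that pos by (intro int_mod_pos_eq[where q = 1]) auto
      then show ?thesis
        using hor[of "a - P" b] False that by simp
    qed (use that in simp)
    finally show ?thesis .
  qed
  have "\<not> occurs_at q u ?z" if q: "q \<in> F" for q u
  proof -
    obtain u1 u2 where u: "u = (u1, u2)" by (cases u)
    have "occurs_at q u ?z \<longleftrightarrow> occurs_at q (s + u1 mod P, u2 mod h) y"
    proof (rule occurs_at_cong[OF F[OF q]])
      fix v assume "v \<in> square r"
      then obtain a b where v: "v = (a, b)" "0 \<le> a" "a < int r" "0 \<le> b" "b < int r"
        by (auto simp: square_def)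
      have "y (s + (u1 mod P + a) mod P, (u2 mod h + b) mod h) = y (s + (u1 mod P + a), u2 mod h + b)"
        using v pos pos_mod_bound[of P u1] pos_mod_bound[of h u2]
          pos_mod_sign[of P u1] pos_mod_sign[of h u2]
        by (intro red) linarith+
      then show "?z (u + v) = y ((s + u1 mod P, u2 mod h) + v)"
        by (simp only: u v(1) add_Pair split mod_add_left_eq add.assoc)
    qed
    then show ?thesis using y q by (simp add: avoiding_def)
  qed
  then show ?thesis by (simp add: avoiding_def)
qed

text \<open>Take logarithms: as \<open>ln (3 ^ k * m) = k * ln 3 + ln m\<close>, the left side
  becomes o(k), while the right side is \<open>k * ln 2\<close>.\<close>

lemma smallo_log_pow_less:
  fixes f :: "nat \<Rightarrow> nat" and b :: nat
  assumes "(\<lambda>n. real (f n)) \<in> o(\<lambda>n. ln (real n))" "0 < m"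
  shows "\<exists>k. b ^ (r * (f (3 ^ k * m) + c)) < 2 ^ k"
proof -
  define B where "B = real (Suc b)"
  define C where "C = real r * ln B"
  have B: "1 \<le> B" by (simp add: B_def)
  have C: "0 \<le> C" using B by (simp add: C_def)
  \<comment> \<open>Chosen so that \<open>C * e * ln 3\<close> is at most \<open>ln 2 / 2\<close>,
    leaving half of \<open>k * ln 2\<close> to absorb the constants; \<open>C + 1\<close> keeps the
    denominator positive.\<close>
  define e where "e = ln 2 / (2 * (C + 1) * ln 3)"
  have e: "0 < e" using C by (simp add: e_def)
  have "\<forall>\<^sub>F n in sequentially. norm (real (f n)) \<le> e * norm (ln (real n))"
    by (rule landau_o.smallD[OF assms(1) e])
  then obtain N where N: "\<And>n. n \<ge> N \<Longrightarrow> real (f n) \<le> e * \<bar>ln (real n)\<bar>"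
    by (auto simp: eventually_sequentially)
  have lim: "\<forall>\<^sub>F k in sequentially. C * (e * (real k * ln 3 + ln (real m)) + real c) < real k * ln 2"
  proof -
    have "C * e * ln 3 \<le> ln 2 / 2"
    proof -
      have "C * e * ln 3 = C / (C + 1) * (ln 2 / 2)" by (simp add: e_def)
      also have "\<dots> \<le> 1 * (ln 2 / 2)" using C by (intro mult_right_mono) auto
      finally show ?thesis by simp
    qed
    then have *: "C * (e * (real k * ln 3 + ln (real m)) + real c)
        \<le> real k * (ln 2 / 2) + C * (e * ln (real m) + real c)" for k
      using mult_left_mono[of "C * e * ln 3" "ln 2 / 2" "real k"] by (simp add: algebra_simps)
    have "\<forall>\<^sub>F k in sequentially. C * (e * ln (real m) + real c) / (ln 2 / 2) < real k"
      by (rule filterlim_at_top_dense[THEN iffD1, rule_format, OF filterlim_real_sequentially])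
    then show ?thesis
    proof eventually_elim
      case (elim k)
      then have "C * (e * ln (real m) + real c) < real k * (ln 2 / 2)"
        by (simp add: field_simps)
      then show ?case using *[of k] by simp
    qed
  qed
  obtain k where k: "N \<le> k" "C * (e * (real k * ln 3 + ln (real m)) + real c) < real k * ln 2"
    using eventually_happens[OF eventually_conj[OF eventually_ge_at_top[of N] lim]] by auto
  let ?n = "3 ^ k * m"
  have "k < 3 ^ k" by (induction k) auto
  moreover have "3 ^ k * 1 \<le> ?n" using assms(2) by (intro mult_le_mono2) simp
  ultimately have "N \<le> ?n" using k(1) by linarith
  from N[OF this] have "real (f ?n) \<le> e * (real k * ln 3 + ln (real m))"
    using assms(2) by (simp add: ln_mult ln_realpow)
  then have "C * (real (f ?n) + real c) < real k * ln 2"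
    using k(2) mult_left_mono[OF _ C, of "real (f ?n) + real c"]
    by (meson add_right_mono order_le_less_trans)
  then have "ln (B ^ (r * (f ?n + c))) < ln (2 ^ k)"
    using B by (simp add: ln_realpow C_def algebra_simps)
  then have "B ^ (r * (f ?n + c)) < 2 ^ k"
    using B by (subst (asm) ln_less_cancel_iff) auto
  then have "real (Suc b ^ (r * (f ?n + c))) < real (2 ^ k)"
    by (simp only: B_def of_nat_power of_nat_numeral)
  then have "Suc b ^ (r * (f ?n + c)) < 2 ^ k" by (simp only: of_nat_less_iff)
  then show ?thesis using power_mono[of b "Suc b"]
    by (metis le_SucI le_refl order_le_less_trans zero_le)
qed


lemma dense_periodic_points:
  fixes X :: "'a::finite config set"
  assumes bg: "block_gluing f X" and "mono f" and "(\<lambda>n. real (f n)) \<in> o(\<lambda>n. ln (real n))"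
    and "\<And>n. f n \<le> n" and sub: "subshift X" and X: "X = avoiding F"
    and F: "\<And>q. q \<in> F \<Longrightarrow> dom q \<subseteq> square r" and x: "x \<in> X"
  shows "\<exists>z\<in>X. \<exists>P>0. (\<forall>i j. z (i mod int P, j mod int P) = z (i, j)) \<and>
    (\<forall>v\<in>square m. z v = x v)"
proof -
  \<comment> \<open>Blocks of size \<open>M\<close> contain the given \<open>m\<close>-block, and a
    strip made of them is at least as high as a window.\<close>
  define M where "M = Suc (max m r)"
  have M: "0 < M" "r \<le> M" "m \<le> M" by (auto simp: M_def)
  obtain k where k: "CARD('a) ^ (r * (f (3 ^ k * M) + 2 * M)) < 2 ^ k"
    using smallo_log_pow_less[OF assms(3) M(1)] by blast
  obtain n S y where "y \<in> X \<and> M \<le> n \<and> n \<le> 3 ^ k * M \<and> finite S \<and> card S = 2 ^ k \<and>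
     (\<forall>s\<in>S. 0 \<le> s \<and> s + int M \<le> int n \<and> (\<forall>v\<in>square M. y ((s, 0) + v) = x v)) \<and>
     (\<forall>s\<in>S. \<forall>t\<in>S. s < t \<longrightarrow> s + int M \<le> t)"
    using block_gluing_copies[OF bg assms(4) x M(1), of k] by (elim exE)
  then have *: "y \<in> X" "M \<le> n" "n \<le> 3 ^ k * M" "finite S" "card S = 2 ^ k"
    "\<And>s. s \<in> S \<Longrightarrow> 0 \<le> s \<and> s + int M \<le> int n"
    "\<And>s v. s \<in> S \<Longrightarrow> v \<in> square M \<Longrightarrow> y ((s, 0) + v) = x v"
    "\<And>s t. s \<in> S \<Longrightarrow> t \<in> S \<Longrightarrow> s < t \<Longrightarrow> s + int M \<le> t"
    by blast+
  define h where "h = int (f n + M)"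
  obtain y' where y': "y' \<in> X"
    "\<And>i j. 0 \<le> i \<Longrightarrow> i < int n \<Longrightarrow> 0 \<le> j \<Longrightarrow> j < int M \<Longrightarrow> y' (i, j) = y (i, j)"
    "\<And>i j. 0 \<le> i \<Longrightarrow> i < int n \<Longrightarrow> 0 \<le> j \<Longrightarrow> j < int M \<Longrightarrow> y' (i, j + h) = y (i, j)"
    using block_gluing_strip[OF bg sub *(1,2)] unfolding h_def by blast
  \<comment> \<open>The seam to be matched: \<open>r\<close> columns, and all rows met by windows
    with corner below \<open>h\<close>. Its values are only counted, so nothing need be known about
    the rows between the two strips.\<close>
  let ?D = "{0..<int r} \<times> {0..<h + int r}"
  let ?\<phi> = "\<lambda>s. restrict (\<lambda>(a, b). y' (s + a, b)) ?D"
  let ?T = "?D \<rightarrow>\<^sub>E (UNIV :: 'a set)"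
  have "card ?T = CARD('a) ^ (r * (f n + M + r))"
    by (simp add: card_PiE card_cartesian_product h_def nat_add_distrib)
  \<comment> \<open>Only an upper bound of the width \<open>n\<close> is known; monotonicity of
    \<open>f\<close> transfers the choice of \<open>k\<close> to it.\<close>
  also have "\<dots> \<le> CARD('a) ^ (r * (f (3 ^ k * M) + 2 * M))"
  proof (rule power_increasing)
    have "f n \<le> f (3 ^ k * M)" using \<open>mono f\<close> *(3) by (rule monoD)
    then show "r * (f n + M + r) \<le> r * (f (3 ^ k * M) + 2 * M)"
      using M by (intro mult_le_mono2) simp
  qed (simp add: Suc_leI)
  finally have "card ?T < card S" using k *(5) by simp
  moreover have "?\<phi> ` S \<subseteq> ?T" by (auto simp: PiE_def)
  moreover have "finite ?T" by (intro finite_PiE) auto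
  ultimately have "\<not> inj_on ?\<phi> S" by (meson card_inj_on_le not_le)
  then obtain s t where st: "s \<in> S" "t \<in> S" "s < t" "?\<phi> s = ?\<phi> t"
    unfolding inj_on_def by (metis linorder_neqE)
  define P where "P = t - s"
  have P: "int M \<le> P" using *(8)[OF st(1-3)] by (simp add: P_def)
  have h: "int M \<le> h" by (simp add: h_def)
  let ?z = "\<lambda>(i, j). y' (s + i mod P, j mod h)"
  have tn: "t + int M \<le> int n" "0 \<le> s" using *(6) st by auto
  have "?z \<in> avoiding F"
  proof (rule avoiding_torus[OF F])
    show "y' \<in> avoiding F" using y' X by simp
    show "y' (s + i, j + h) = y' (s + i, j)" if "0 \<le> i" "i < P" "0 \<le> j" "j < int r" for i j
      using that tn M y'(2,3)[of "s + i" j] by (simp add: P_def)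
    show "y' (s + P + i, j) = y' (s + i, j)"
      if "0 \<le> i" "i < int r" "0 \<le> j" "j < h + int r" for i j
      using fun_cong[OF st(4), of "(i, j)"] that by (simp add: P_def)
  qed (use P h M in auto)
  moreover have "?z v = x v" if v: "v \<in> square m" for v
  proof -
    obtain i j where ij: "v = (i, j)" "0 \<le> i" "i < int m" "0 \<le> j" "j < int m"
      using v by (auto simp: square_def)
    then have "?z v = y' (s + i, j)" using P h M by simp
    also have "\<dots> = y (s + i, j)" using ij tn P M by (intro y') (auto simp: P_def)
    also have "\<dots> = x v" using *(7)[OF st(1), of v] ij M by (simp add: square_def)
    finally show ?thesis .
  qed
  \<comment> \<open>The horizontal period \<open>P\<close> and the vertical period \<open>h\<close>
    are replaced by the common period \<open>P * h\<close>.\<close>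
  moreover have "?z (i mod int (nat (P * h)), j mod int (nat (P * h))) = ?z (i, j)" for i j
    using P h M by (simp add: mod_mod_cancel)
  moreover have "0 < nat (P * h)" using P h M by (simp add: zero_less_mult_iff)
  ultimately show ?thesis using X by (intro bexI[of _ ?z] exI[of _ "nat (P * h)"]) auto
qed

text \<open>Membership in \<open>C n\<close> depends on finitely many coordinates, so
  \<open>C n\<close> is closed in the product topology. The product is compact, hence nested
  nonempty closed sets have a common point.\<close>

lemma compactness_finite_alphabet:
  fixes C :: "nat \<Rightarrow> ('v \<Rightarrow> 'a::finite) set"
  assumes "\<And>n. C n \<noteq> {}" "decseq C"
    and local: "\<And>n. \<exists>D. finite D \<and> (\<forall>x\<in>C n. \<forall>y. (\<forall>v\<in>D. x v = y v) \<longrightarrow> y \<in> C n)"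
  shows "(\<Inter>n. C n) \<noteq> {}"
proof -
  let ?T = "product_topology (\<lambda>_ :: 'v. discrete_topology (UNIV :: 'a set)) UNIV"
  have "compact_space ?T"
    by (simp add: compact_space_product_topology compact_space_discrete_topology)
  moreover have "closedin ?T (C n)" for n
  proof -
    obtain D where D: "finite D" "\<forall>x\<in>C n. \<forall>y. (\<forall>v\<in>D. x v = y v) \<longrightarrow> y \<in> C n"
      using local[of n] by auto
    have "openin ?T (- C n)"
    proof (subst openin_subopen, intro ballI)
      fix y assume y: "y \<in> - C n"
      let ?U = "PiE UNIV (\<lambda>v. if v \<in> D then {y v} else UNIV)"
      have "finite {v. (if v \<in> D then {y v} else UNIV) \<noteq> UNIV}"
        by (rule finite_subset[OF _ D(1)]) auto
      then have "openin ?T ?U"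
        by (intro product_topology_basis) simp_all
      moreover have "y \<in> ?U" by auto
      moreover have "?U \<subseteq> - C n"
      proof
        fix z assume z: "z \<in> ?U"
        have "z v = y v" if "v \<in> D" for v using PiE_mem[OF z, of v] that by simp
        then show "z \<in> - C n" using D(2)[rule_format, of z y] y by auto
      qed
      ultimately show "\<exists>U. openin ?T U \<and> y \<in> U \<and> U \<subseteq> - C n" by blast
    qed
    then show ?thesis by (simp add: closedin_def Compl_eq_Diff_UNIV)
  qed
  ultimately show ?thesis using assms(1,2) by (intro compact_space_imp_nest) auto
qed


section \<open>Patterns given by codes\<close>

definition entry_pos :: "nat \<Rightarrow> int \<times> int" where
  "entry_pos t = (let p = prod_decode (fst (prod_decode t))
     in (int_decode (fst p), int_decode (snd p)))"

text \<open>Meaningful for every number \<open>w\<close>, since the procedure must halt on every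
  input; contradictory entries or numbers coding no letter merely make it false.\<close>

definition agrees :: "'a::finite config \<Rightarrow> nat \<Rightarrow> bool" where
  "agrees x w \<longleftrightarrow> (\<forall>t\<in>set (list_decode w). to_nat (x (entry_pos t)) = snd (prod_decode t))"

lemma agrees_pattern_code: "agrees x (pattern_code l) \<longleftrightarrow> (\<forall>(v, a)\<in>set l. x v = a)"
proof -
  have "agrees x (pattern_code l) \<longleftrightarrow> (\<forall>((i, j), a)\<in>set l. to_nat (x (i, j)) = to_nat a)"
    by (simp add: agrees_def pattern_code_def entry_pos_def case_prod_unfold)
  then show ?thesis by (simp add: case_prod_unfold)
qed

text \<open>Shift invariance moves an occurrence to the origin, and distinct positions ensure that
  \<open>map_of l\<close> keeps every entry of \<open>l\<close>.\<close>

lemma map_of_in_language_iff: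
  assumes "subshift X" "distinct (map fst l)"
  shows "map_of l \<in> language X \<longleftrightarrow> (\<exists>x\<in>X. agrees x (pattern_code l))"
proof -
  have occ: "occurs_at (map_of l) u x \<longleftrightarrow> (\<forall>(v, a)\<in>set l. x (u + v) = a)" for u x
  proof -
    have "(v \<in> dom p \<longrightarrow> p v = Some a) \<longleftrightarrow> (\<forall>a'. p v = Some a' \<longrightarrow> a = a')"
      for p :: "'a pattern" and v a by auto
    then have "occurs_at (map_of l) u x \<longleftrightarrow> (\<forall>v a. map_of l v = Some a \<longrightarrow> x (u + v) = a)"
      unfolding occurs_at_def Ball_def by simp
    then show ?thesis using assms(2) by auto
  qed
  have "map_of l \<in> language X \<longleftrightarrow> (\<exists>x\<in>X. \<exists>u. occurs_at (map_of l) 0 (shift u x))"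
    by (simp add: language_def occurs_at_shift finite_dom_map_of)
  also have "\<dots> \<longleftrightarrow> (\<exists>x\<in>X. occurs_at (map_of l) 0 x)"
  proof
    assume "\<exists>x\<in>X. occurs_at (map_of l) 0 x"
    then obtain x where "x \<in> X" "occurs_at (map_of l) 0 (shift 0 x)"
      by (auto simp: occurs_at_shift)
    then show "\<exists>x\<in>X. \<exists>u. occurs_at (map_of l) 0 (shift u x)" by blast
  qed (use subshift_shift[OF assms(1)] in blast)
  finally show ?thesis by (simp add: agrees_pattern_code occ)
qed

lemma int_decode_bounds: "d < w \<Longrightarrow> - int w \<le> int_decode d \<and> int_decode d < int w"
  by (auto simp: int_decode_def sum_decode_def)

text \<open>Pair and list codes dominate what they encode, so \<open>w\<close> itself tells how
  large a torus must be to hold the pattern.\<close>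

lemma entry_pos_bounds:
  assumes "t \<in> set (list_decode w)"
  shows "fst (entry_pos t) \<in> {- int w..<int w}" "snd (entry_pos t) \<in> {- int w..<int w}"
proof -
  have le: "fst (prod_decode z) \<le> z" "snd (prod_decode z) \<le> z" for z
    using le_prod_encode_1[of "fst (prod_decode z)" "snd (prod_decode z)"]
      le_prod_encode_2[of "snd (prod_decode z)" "fst (prod_decode z)"] by simp_all
  have "t < w" using list_encode_bounds(2)[OF assms] by simp
  then have "fst (prod_decode (fst (prod_decode t))) < w" "snd (prod_decode (fst (prod_decode t))) < w"
    using le[of t] le[of "fst (prod_decode t)"] by linarith+
  then show "fst (entry_pos t) \<in> {- int w..<int w}" "snd (entry_pos t) \<in> {- int w..<int w}"
    using int_decode_bounds by (auto simp: entry_pos_def Let_def)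
qed


section \<open>Tori coded by numbers\<close>

definition digit :: "nat \<Rightarrow> nat \<Rightarrow> nat \<Rightarrow> nat" where
  "digit B k c = c div B ^ k mod B"

lemma ex_digits:
  assumes "0 < B" "\<And>k. k < K \<Longrightarrow> g k < B"
  shows "\<exists>c<B ^ K. \<forall>k<K. digit B k c = g k"
  using assms(2)
proof (induction K)
  case (Suc K)
  have "\<exists>c<B ^ K. \<forall>k<K. digit B k c = g k"
    by (rule Suc.IH) (simp add: Suc.prems)
  then obtain c where c: "c < B ^ K" "\<And>k. k < K \<Longrightarrow> digit B k c = g k"
    by auto
  have g: "g K < B" using Suc.prems by blast
  let ?c = "c + g K * B ^ K"
  have "?c < B ^ K + g K * B ^ K" using c by simp
  also have "\<dots> = Suc (g K) * B ^ K" by simp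
  also have "\<dots> \<le> B * B ^ K" using g by (intro mult_le_mono1) simp
  finally have "?c < B ^ Suc K" by simp
  moreover have "digit B k ?c = g k" if "k < Suc K" for k
  proof (cases "k = K")
    case True
    then show ?thesis using c(1) g assms(1) by (simp add: digit_def)
  next
    case False
    with that have k: "k < K" by simp
    \<comment> \<open>The new summand is a multiple of \<open>B ^ Suc k\<close>, so it leaves digit
      \<open>k\<close> unchanged.\<close>
    let ?M = "B ^ (K - Suc k)"
    have "B ^ K = B ^ (k + Suc (K - Suc k))" using k by simp
    then have "?c = c + (B * (g K * ?M)) * B ^ k"
      by (simp only: power_add power_Suc ac_simps)
    also have "\<dots> div B ^ k = B * (g K * ?M) + c div B ^ k"
      by (rule div_mult_self1) (use assms(1) in simp)
    finally have "digit B k ?c = digit B k c"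
      by (simp add: digit_def)
    then show ?thesis using c(2) k by simp
  qed
  ultimately show ?case by blast
qed auto

text \<open>The side is \<open>2 * N\<close>, so the square from \<open>- N\<close> to
  \<open>N - 1\<close> is a fundamental domain. The numbering \<open>e\<close> is meant to be a
  bijection onto the digits in base \<open>CARD('a)\<close>, so that every \<open>c\<close> codes a
  colouring.\<close>

definition torus :: "('a::finite \<Rightarrow> nat) \<Rightarrow> nat \<Rightarrow> nat \<Rightarrow> 'a config" where
  "torus e N c = (\<lambda>(i, j). inv e
     (digit CARD('a) (nat (i mod int (2 * N)) * (2 * N) + nat (j mod int (2 * N))) c))"

lemma torus_letter:
  fixes e :: "'a::finite \<Rightarrow> nat"
  assumes "bij_betw e UNIV {..<CARD('a)}"
  shows "torus e N c (i, j) = a \<longleftrightarrow>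
    digit CARD('a) (nat (i mod int (2 * N)) * (2 * N) + nat (j mod int (2 * N))) c = e a"
proof -
  have "digit CARD('a) k c \<in> range e" for k
    using assms by (simp add: bij_betw_def digit_def)
  moreover have "inj e" using assms by (simp add: bij_betw_def)
  ultimately show ?thesis by (auto simp: torus_def f_inv_into_f)
qed

lemma torus_mod_eqI:
  "i mod int (2 * N) = i' mod int (2 * N) \<Longrightarrow> j mod int (2 * N) = j' mod int (2 * N) \<Longrightarrow>
   torus e N c (i, j) = torus e N c (i', j')"
  by (simp add: torus_def)

lemma occurs_at_torus_mod_eqI:
  assumes "i mod int (2 * N) = i' mod int (2 * N)" "j mod int (2 * N) = j' mod int (2 * N)"
  shows "occurs_at q (i, j) (torus e N c) \<longleftrightarrow> occurs_at q (i', j') (torus e N c)"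
proof (rule occurs_at_cong[OF subset_UNIV])
  fix v :: "int \<times> int"
  show "torus e N c ((i, j) + v) = torus e N c ((i', j') + v)"
    using assms by (cases v) (auto intro!: torus_mod_eqI intro: mod_add_cong)
qed

lemma ex_torus:
  fixes x :: "'a::finite config"
  assumes e: "bij_betw e UNIV {..<CARD('a)}" and N: "0 < N"
  shows "\<exists>c<CARD('a) ^ (2 * N * (2 * N)). \<forall>i\<in>{- int N..<int N}. \<forall>j\<in>{- int N..<int N}.
    torus e N c (i, j) = x (i, j)"
proof -
  \<comment> \<open>\<open>rep k\<close> represents the residue \<open>k\<close> modulo
    \<open>2 * N\<close> in the interval from \<open>- N\<close> to \<open>N - 1\<close>.\<close>
  define rep where "rep k = (if k < N then int k else int k - int (2 * N))" for k
  have rep: "rep (nat (i mod int (2 * N))) = i" "nat (i mod int (2 * N)) < 2 * N"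
    if "i \<in> {- int N..<int N}" for i
  proof -
    show "nat (i mod int (2 * N)) < 2 * N" using N by (simp add: nat_less_iff)
    show "rep (nat (i mod int (2 * N))) = i"
    proof (cases "0 \<le> i")
      case True
      then show ?thesis using that by (simp add: rep_def nat_less_iff)
    next
      case False
      then have "i mod int (2 * N) = i + int (2 * N)"
        using that by (intro int_mod_pos_eq[where q = "- 1"]) auto
      then show ?thesis using that False by (auto simp: rep_def)
    qed
  qed
  let ?g = "\<lambda>k. e (x (rep (k div (2 * N)), rep (k mod (2 * N))))"
  have "e a < CARD('a)" for a using e by (auto simp: bij_betw_def)
  then obtain c where c: "c < CARD('a) ^ (2 * N * (2 * N))"
      "\<And>k. k < 2 * N * (2 * N) \<Longrightarrow> digit CARD('a) k c = ?g k"
    using ex_digits[of "CARD('a)" "2 * N * (2 * N)" ?g] by auto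
  have "torus e N c (i, j) = x (i, j)" if "i \<in> {- int N..<int N}" "j \<in> {- int N..<int N}" for i j
  proof -
    let ?i = "nat (i mod int (2 * N))" and ?j = "nat (j mod int (2 * N))"
    have "Suc ?i * (2 * N) \<le> 2 * N * (2 * N)"
      using rep(2)[OF that(1)] by (intro mult_le_mono1) simp
    then have "?i * (2 * N) + ?j < 2 * N * (2 * N)"
      using rep(2)[OF that(2)] by simp
    from c(2)[OF this] show ?thesis
      unfolding torus_letter[OF e]
      using rep(1)[OF that(1)] rep(1)[OF that(2)] rep(2)[OF that(2)] N by simp
  qed
  then show ?thesis using c(1) by blast
qed

text \<open>With \<open>s = 2 * N\<close> all windows of the torus are tested; with \<open>s = 2 * N - r\<close> only those
  that lie in the square \<open>[-N, N) \<times> [-N, N)\<close>, because position \<open>N + i\<close> represents \<open>i - N\<close>.\<close>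

definition extendable :: "('a::finite \<Rightarrow> nat) \<Rightarrow> 'a pattern set \<Rightarrow> nat \<Rightarrow> nat \<Rightarrow> nat \<Rightarrow> bool" where
  "extendable e F s N w \<longleftrightarrow> (\<exists>c<CARD('a) ^ (2 * N * (2 * N)). agrees (torus e N c) w \<and>
     (\<forall>i<s. \<forall>j<s. \<forall>q\<in>F. \<not> occurs_at q (int (N + i), int (N + j)) (torus e N c)))"

lemma extendable_torusD:
  assumes "extendable e F (2 * N) N w" "0 < N"
  shows "\<exists>x\<in>avoiding F. agrees x w"
proof -
  obtain c where c: "agrees (torus e N c) w"
    "\<And>i j q. i < 2 * N \<Longrightarrow> j < 2 * N \<Longrightarrow> q \<in> F \<Longrightarrow> \<not> occurs_at q (int (N + i), int (N + j)) (torus e N c)"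
    using assms(1) unfolding extendable_def by blast
  have "\<not> occurs_at q (a, b) (torus e N c)" if "q \<in> F" for q a b
  proof -
    \<comment> \<open>The corner \<open>N + ?r a\<close> is congruent to \<open>a\<close>, so the
      finitely many tests cover all windows.\<close>
    let ?r = "\<lambda>a. nat ((a - int N) mod int (2 * N))"
    have r: "?r a < 2 * N" "int (N + ?r a) mod int (2 * N) = a mod int (2 * N)" for a
      using assms(2) by (simp_all add: nat_less_iff mod_add_right_eq)
    show ?thesis
      using c(2)[OF r(1) r(1) that] occurs_at_torus_mod_eqI[OF r(2) r(2)] by blast
  qed
  then show ?thesis using c(1) by (intro bexI[of _ "torus e N c"]) (auto simp: avoiding_def)
qed

text \<open>A period dividing \<open>N\<close> divides the side \<open>2 * N\<close>, so
  \<open>z\<close> is itself a coded torus.\<close>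

lemma extendable_if_periodic:
  fixes z :: "'a::finite config"
  assumes e: "bij_betw e UNIV {..<CARD('a)}" and z: "z \<in> avoiding F" "agrees z w"
    and per: "\<And>i j. z (i mod int P, j mod int P) = z (i, j)" and N: "0 < N" "P dvd N"
  shows "extendable e F (2 * N) N w"
proof -
  obtain c where c: "c < CARD('a) ^ (2 * N * (2 * N))"
    "\<And>i j. i \<in> {- int N..<int N} \<Longrightarrow> j \<in> {- int N..<int N} \<Longrightarrow> torus e N c (i, j) = z (i, j)"
    using ex_torus[OF e N(1), of z] by blast
  have "torus e N c (i, j) = z (i, j)" for i j
  proof -
    let ?r = "\<lambda>a. (a + int N) mod int (2 * N) - int N"
    have "?r a \<in> {- int N..<int N}" for a
      using N(1) pos_mod_bound[of "int (2 * N)" "a + int N"] by auto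
    then have "torus e N c (?r i, ?r j) = z (?r i, ?r j)" by (intro c(2))
    moreover have r: "?r a mod int (2 * N) = a mod int (2 * N)" for a
      by (simp add: mod_diff_left_eq)
    have "?r a mod int P = a mod int P" for a
    proof -
      have "int P dvd int (2 * N)" using N(2) by simp
      then show ?thesis using r[of a] by (metis mod_mod_cancel)
    qed
    then have "z (?r i, ?r j) = z (i, j)"
      using per[of "?r i" "?r j"] per[of i j] by (simp only:)
    moreover have "torus e N c (?r i, ?r j) = torus e N c (i, j)"
      by (rule torus_mod_eqI[OF r r])
    ultimately show ?thesis by (simp only:)
  qed
  then have "torus e N c = z" by auto
  with z have "agrees (torus e N c) w" "\<forall>q\<in>F. \<forall>u. \<not> occurs_at q u (torus e N c)"
    unfolding avoiding_def by simp_all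
  then show ?thesis using c(1) unfolding extendable_def by (intro exI[of _ c]) simp
qed

text \<open>Colour the fundamental square as in \<open>x\<close>. It contains all entries of
  \<open>w\<close> because \<open>w\<close> is at most \<open>N\<close>, and the tested windows do
  not cross its boundary, so they are windows of \<open>x\<close>.\<close>

lemma extendable_if_agrees:
  fixes x :: "'a::finite config"
  assumes e: "bij_betw e UNIV {..<CARD('a)}" and x: "x \<in> avoiding F" "agrees x w"
    and F: "\<And>q. q \<in> F \<Longrightarrow> dom q \<subseteq> square r" and N: "0 < N" "w \<le> N"
  shows "extendable e F (2 * N - r) N w"
proof -
  obtain c where c: "c < CARD('a) ^ (2 * N * (2 * N))"
    "\<And>i j. i \<in> {- int N..<int N} \<Longrightarrow> j \<in> {- int N..<int N} \<Longrightarrow> torus e N c (i, j) = x (i, j)"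
    using ex_torus[OF e N(1), of x] by blast
  have "torus e N c (entry_pos t) = x (entry_pos t)" if "t \<in> set (list_decode w)" for t
    using c(2)[of "fst (entry_pos t)" "snd (entry_pos t)"] entry_pos_bounds[OF that] N(2) by auto
  then have "agrees (torus e N c) w"
    using x(2) unfolding agrees_def by simp
  moreover have "\<not> occurs_at q (int (N + i), int (N + j)) (torus e N c)"
    if "i < 2 * N - r" "j < 2 * N - r" "q \<in> F" for i j q
  proof -
    let ?t = "\<lambda>i. int i - int N"
    have m: "int (N + i) mod int (2 * N) = ?t i mod int (2 * N)" for i
      using mod_add_self2[of "?t i" "int (2 * N)"] by (simp add: algebra_simps)
    have "occurs_at q (int (N + i), int (N + j)) (torus e N c) \<longleftrightarrow>
        occurs_at q (?t i, ?t j) (torus e N c)"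
      by (rule occurs_at_torus_mod_eqI[OF m m])
    also have "\<dots> \<longleftrightarrow> occurs_at q (?t i, ?t j) x"
    proof (rule occurs_at_cong[OF F[OF that(3)]])
      fix v assume "v \<in> square r"
      then show "torus e N c ((?t i, ?t j) + v) = x ((?t i, ?t j) + v)"
        using that(1,2) by (cases v) (auto simp: square_def intro!: c(2))
    qed
    finally show ?thesis using x(1) that(3) by (auto simp: avoiding_def)
  qed
  ultimately show ?thesis using c(1) unfolding extendable_def by blast
qed

text \<open>Compactness: tori of growing size satisfy the constraints in growing squares, and a
  common point of these conditions satisfies all of them.\<close>

lemma agrees_if_extendable:
  assumes F: "\<And>q. q \<in> F \<Longrightarrow> dom q \<subseteq> square r"
    and ext: "\<And>N. w \<le> N \<Longrightarrow> extendable e F (2 * Suc N - r) (Suc N) w"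
  shows "\<exists>x\<in>avoiding F. agrees x w"
proof -
  \<comment> \<open>Corner coordinates whose \<open>r\<close>-windows stay in the square from
    \<open>- n\<close> to \<open>n - 1\<close>.\<close>
  let ?I = "\<lambda>n. {- int n..<int n - int r}"
  define C where "C n = {y. agrees y w \<and> (\<forall>a\<in>?I n. \<forall>b\<in>?I n. \<forall>q\<in>F. \<not> occurs_at q (a, b) y)}" for n
  have "(\<Inter>n. C n) \<noteq> {}"
  proof (rule compactness_finite_alphabet)
    fix n
    \<comment> \<open>Larger than \<open>n\<close>, so that the tests include all constraints of
      \<open>C n\<close>, and larger than \<open>w\<close>, as \<open>ext\<close> requires.\<close>
    let ?N = "Suc (n + w)"
    obtain c where c: "agrees (torus e ?N c) w"
      "\<And>i j q. i < 2 * ?N - r \<Longrightarrow> j < 2 * ?N - r \<Longrightarrow> q \<in> F \<Longrightarrow>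
        \<not> occurs_at q (int (?N + i), int (?N + j)) (torus e ?N c)"
      using ext[OF le_add2[of w n]] unfolding extendable_def by blast
    have "\<not> occurs_at q (a, b) (torus e ?N c)" if "a \<in> ?I n" "b \<in> ?I n" "q \<in> F" for a b q
    proof -
      let ?r = "\<lambda>a. nat (a + int ?N)"
      have "?r a < 2 * ?N - r" "int (?N + ?r a) mod int (2 * ?N) = a mod int (2 * ?N)"
        if "a \<in> ?I n" for a
      proof -
        show "?r a < 2 * ?N - r" using that by auto
        have "int (?N + ?r a) = a + int (2 * ?N)" using that by auto
        then show "int (?N + ?r a) mod int (2 * ?N) = a mod int (2 * ?N)"
          by (simp only: mod_add_self2)
      qed
      from this[OF that(1)] this[OF that(2)] show ?thesis
        using c(2)[of "?r a" "?r b" q] that(3) occurs_at_torus_mod_eqI by metis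
    qed
    then have "torus e ?N c \<in> C n" using c(1) by (auto simp: C_def)
    then show "C n \<noteq> {}" by blast
    show "\<exists>D. finite D \<and> (\<forall>x\<in>C n. \<forall>y. (\<forall>v\<in>D. x v = y v) \<longrightarrow> y \<in> C n)"
    proof (intro exI conjI ballI allI impI)
      let ?D = "entry_pos ` set (list_decode w) \<union> {- int n..<int n} \<times> {- int n..<int n}"
      show "finite ?D" by simp
      fix x y assume x: "x \<in> C n" and xy: "\<forall>v\<in>?D. x v = y v"
      have "agrees y w" using x xy by (auto simp: C_def agrees_def)
      moreover have "\<not> occurs_at q (a, b) y" if "a \<in> ?I n" "b \<in> ?I n" "q \<in> F" for a b q
      proof -
        have "occurs_at q (a, b) x \<longleftrightarrow> occurs_at q (a, b) y"
        proof (rule occurs_at_cong[OF F[OF that(3)]])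
          fix v assume "v \<in> square r"
          then have "(a, b) + v \<in> ?D"
            using that(1,2) by (cases v) (auto simp: square_def)
          then show "x ((a, b) + v) = y ((a, b) + v)" by (rule xy[THEN bspec])
        qed
        then show ?thesis using x that by (auto simp: C_def)
      qed
      ultimately show "y \<in> C n" by (auto simp: C_def)
    qed
  next
    show "decseq C"
      unfolding decseq_def by (auto simp: C_def)
  qed
  then obtain x where x: "\<And>n. x \<in> C n" by blast
  have "\<not> occurs_at q (a, b) x" if "q \<in> F" for q a b
  proof -
    have "a \<in> ?I (nat (\<bar>a\<bar> + \<bar>b\<bar>) + r + 1)" "b \<in> ?I (nat (\<bar>a\<bar> + \<bar>b\<bar>) + r + 1)" by auto
    then show ?thesis using x[of "nat (\<bar>a\<bar> + \<bar>b\<bar>) + r + 1"] that unfolding C_def by blast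
  qed
  then have "x \<in> avoiding F" by (auto simp: avoiding_def)
  moreover have "agrees x w" using x by (auto simp: C_def)
  ultimately show ?thesis by blast
qed


section \<open>The decision procedure\<close>

lemma recf_digit:
  assumes "recf n k" "recf n c"
  shows "recf n (\<lambda>xs. digit B (k xs) (c xs))"
  unfolding digit_def by (intro recf_mod recf_div recf_power recf_const assms)

lemma recp_agrees_torus:
  fixes e :: "'a::finite \<Rightarrow> nat"
  assumes e: "bij_betw e UNIV {..<CARD('a)}" and "recf n N" "recf n c" "recf n w"
    and N: "\<And>xs. length xs = n \<Longrightarrow> 0 < N xs"
  shows "recp n (\<lambda>xs. agrees (torus e (N xs) (c xs)) (w xs))"
proof -
  let ?p = "\<lambda>t. prod_decode (fst (prod_decode t))"
  \<comment> \<open>The maps \<open>to_nat\<close> and \<open>e\<close> enter only through finitely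
    many constants, by a disjunction over the letters.\<close>
  have eq: "to_nat (torus e N c (entry_pos t)) = m \<longleftrightarrow> (\<exists>a\<in>UNIV.
      digit CARD('a) (nat (int_decode (fst (?p t)) mod int (2 * N)) * (2 * N) +
        nat (int_decode (snd (?p t)) mod int (2 * N))) c = e a \<and> to_nat a = m)" for N c t m
    unfolding entry_pos_def Let_def torus_letter[OF e, symmetric] by auto
  show ?thesis
    unfolding agrees_def eq
    by (intro recp_Ball_set_list_decode recp_finite_Bex recp_conj recp_eq recf_digit recf_add
        recf_mult recf_int_decode_mod recf_const recf_fst_prod_decode recf_snd_prod_decode
        recf_hd recf_tl assms finite) (use N in auto)
qed

lemma recp_windows_torus:
  fixes e :: "'a::finite \<Rightarrow> nat"
  assumes e: "bij_betw e UNIV {..<CARD('a)}" and F: "finite F" "\<And>q. q \<in> F \<Longrightarrow> dom q \<subseteq> square r"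
    and "recf n N" "recf n c" "recf n s"
  shows "recp n (\<lambda>xs. \<forall>i<s xs. \<forall>j<s xs. \<forall>q\<in>F.
    \<not> occurs_at q (int (N xs + i), int (N xs + j)) (torus e (N xs) (c xs)))"
proof -
  have fin: "finite (dom q)" if "q \<in> F" for q
    using F(2)[OF that] by (rule finite_subset) (simp add: square_def)
  \<comment> \<open>Supports have nonnegative coordinates, so positions are sums of natural numbers;
    the quantifiers over \<open>F\<close> and \<open>dom q\<close> unfold to fixed Boolean
    combinations.\<close>
  have eq: "(\<forall>q\<in>F. \<not> occurs_at q (int (N + i), int (N + j)) (torus e N c)) \<longleftrightarrow>
      (\<forall>q\<in>F. \<exists>v\<in>dom q. digit CARD('a) ((N + i + nat (fst v)) mod (2 * N) * (2 * N) +
        (N + j + nat (snd v)) mod (2 * N)) c \<noteq> e (the (q v)))" for N i j c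
  proof (rule ball_cong[OF refl])
    fix q assume q: "q \<in> F"
    have "q v = Some (torus e N c ((int (N + i), int (N + j)) + v)) \<longleftrightarrow>
        digit CARD('a) ((N + i + nat (fst v)) mod (2 * N) * (2 * N) +
        (N + j + nat (snd v)) mod (2 * N)) c = e (the (q v))" if v: "v \<in> dom q" for v
    proof -
      obtain a b where ab: "v = (int a, int b)"
        using v F(2)[OF q] by (cases v) (force simp: square_def elim!: nonneg_int_cases)
      have [simp]: "nat ((int k + int l) mod (2 * int N)) = (k + l) mod (2 * N)" for k l
        by (metis nat_int of_nat_add of_nat_mod of_nat_mult of_nat_numeral)
      have "q v = Some (torus e N c ((int (N + i), int (N + j)) + v)) \<longleftrightarrow>
          torus e N c (int (N + i) + int a, int (N + j) + int b) = the (q v)"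
        using v ab by auto
      then show ?thesis unfolding torus_letter[OF e] using ab
        by (simp del: of_nat_add)
    qed
    then show "(\<not> occurs_at q (int (N + i), int (N + j)) (torus e N c)) \<longleftrightarrow>
       (\<exists>v\<in>dom q. digit CARD('a) ((N + i + nat (fst v)) mod (2 * N) * (2 * N) +
        (N + j + nat (snd v)) mod (2 * N)) c \<noteq> e (the (q v)))"
      by (auto simp: occurs_at_def)
  qed
  have N: "recf (Suc (Suc n)) (\<lambda>ys. N (tl (tl ys)))" "recf (Suc (Suc n)) (\<lambda>ys. c (tl (tl ys)))"
    using recf_drop[of n _ 2] assms by (simp_all add: drop_Suc numeral_2_eq_2)
  show ?thesis
    unfolding eq
    by (intro recp_bounded_all recp_finite_Ball recp_finite_Bex recp_not recp_eq recf_digit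
        recf_add recf_mult recf_mod recf_const N recf_hd recf_tl[where f = hd]
        recf_tl[where f = s] F(1) fin assms)
qed

lemma recp_extendable:
  fixes e :: "'a::finite \<Rightarrow> nat"
  assumes e: "bij_betw e UNIV {..<CARD('a)}" and F: "finite F" "\<And>q. q \<in> F \<Longrightarrow> dom q \<subseteq> square r"
    and N: "recf n N" "\<And>xs. length xs = n \<Longrightarrow> 0 < N xs" and "recf n s" "recf n w"
  shows "recp n (\<lambda>xs. extendable e F (s xs) (N xs) (w xs))"
  unfolding extendable_def
  by (intro recp_bounded_ex recp_conj recp_agrees_torus[OF e] recp_windows_torus[OF e F]
      recf_power recf_mult recf_const recf_hd recf_tl assms) (use N in auto)

theorem proposition24:
  fixes f :: "nat \<Rightarrow> nat" and X :: "'a::finite config set"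
  assumes "computable f"
    and "mono f"
    and "(\<lambda>n. real (f n)) \<in> o(\<lambda>n. ln (real n))"
    and "\<And>n. f n \<le> n"
    and "subshift X"
    and "finite_type X"
    and "block_gluing f X"
  shows "decidable (language X)"
proof -
  obtain F r where F: "finite F" "\<And>q. q \<in> F \<Longrightarrow> dom q \<subseteq> square r" and X: "X = avoiding F"
    using finite_type_windowE[OF assms(6)] by metis
  obtain e :: "'a \<Rightarrow> nat" where e: "bij_betw e UNIV {..<CARD('a)}"
    using ex_bij_betw_finite_nat[of "UNIV :: 'a set"] by (auto simp: atLeast0LessThan)
  \<comment> \<open>Success of \<open>?yes\<close> exhibits a periodic configuration containing the
    pattern; success of \<open>?no\<close> with \<open>N\<close> at least \<open>w\<close> refutes
    membership. \<open>Suc N\<close> keeps the side positive.\<close>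
  let ?yes = "\<lambda>N w. extendable e F (2 * Suc N) (Suc N) w"
  let ?no = "\<lambda>N w. \<not> extendable e F (2 * Suc N - r) (Suc N) w"
  let ?N = "\<lambda>w. LEAST N. w \<le> N \<and> (?yes N w \<or> ?no N w)"
  have ex: "\<exists>N. w \<le> N \<and> (?yes N w \<or> ?no N w)" for w
  proof (cases "\<exists>x\<in>X. agrees x w")
    case True
    then obtain x where x: "x \<in> X" "agrees x w" by blast
    \<comment> \<open>The shift moves the square from \<open>- w\<close> to \<open>w - 1\<close>,
      which holds all entries, to the corner at the origin where the periodic approximation
      applies.\<close>
    let ?u = "(- int w, - int w)"
    obtain z P where z: "z \<in> X" "0 < P" "\<And>i j. z (i mod int P, j mod int P) = z (i, j)"
      "\<And>v. v \<in> square (2 * w) \<Longrightarrow> z v = shift ?u x v"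
      using dense_periodic_points[OF assms(7,2-5) X F(2) subshift_shift[OF assms(5) x(1)],
          of "2 * w" ?u]
      by blast
    let ?z = "shift (int w, int w) z"
    have "?z (entry_pos t) = x (entry_pos t)" if "t \<in> set (list_decode w)" for t
      using entry_pos_bounds[OF that] z(4)[of "(int w, int w) + entry_pos t"]
      by (cases "entry_pos t") (auto simp: shift_def square_def)
    then have "agrees ?z w" using x(2) by (simp add: agrees_def)
    moreover have "?z \<in> avoiding F" using subshift_shift[OF assms(5) z(1)] X by simp
    moreover have "?z (i mod int P, j mod int P) = ?z (i, j)" for i j
      using z(3)[of "int w + i mod int P" "int w + j mod int P"] z(3)[of "int w + i" "int w + j"]
      by (simp add: shift_def mod_add_right_eq)
    \<comment> \<open>\<open>P * Suc w\<close> is a multiple of the period and exceeds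
      \<open>w\<close>, so the search succeeds at its predecessor at the latest.\<close>
    ultimately have "extendable e F (2 * (P * Suc w)) (P * Suc w) w"
      using z(2) by (intro extendable_if_periodic[OF e, where P = P and z = ?z]) auto
    moreover have "Suc (P * Suc w - 1) = P * Suc w" "w \<le> P * Suc w - 1"
      using z(2) by (cases P; simp)+
    ultimately show ?thesis by (intro exI[of _ "P * Suc w - 1"]) metis
  next
    case False
    then obtain N where "w \<le> N" "\<not> extendable e F (2 * Suc N - r) (Suc N) w"
      using agrees_if_extendable[OF F(2)] X by blast
    then show ?thesis by blast
  qed
  have yes: "?yes (?N w) w \<longleftrightarrow> (\<exists>x\<in>X. agrees x w)" for w
  proof
    assume "?yes (?N w) w"
    then show "\<exists>x\<in>X. agrees x w" unfolding X by (rule extendable_torusD) simp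
  next
    assume "\<exists>x\<in>X. agrees x w"
    then obtain x where x: "x \<in> avoiding F" "agrees x w" using X by blast
    \<comment> \<open>One of the tests succeeds where the search stops. If the pattern extends to
      \<open>x\<close>, then \<open>?no\<close> fails there, so it is \<open>?yes\<close> that
      succeeded.\<close>
    have "w \<le> ?N w \<and> (?yes (?N w) w \<or> ?no (?N w) w)"
      using ex by (rule LeastI_ex)
    moreover from this have "\<not> ?no (?N w) w"
      using extendable_if_agrees[OF e x F(2), of "Suc (?N w)"] by auto
    ultimately show "?yes (?N w) w" by blast
  qed
  have ext: "recp n (\<lambda>xs. extendable e F (s xs) (Suc (N xs)) (w xs))"
    if "recf n s" "recf n N" "recf n w" for n s N w
    by (rule recp_extendable[OF e F]) (use that in \<open>auto intro: recf_Suc\<close>)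
  have w: "recf (Suc 1) (\<lambda>ys. tl ys ! 0)"
    by (rule recf_tl[OF recf_nth]) simp
  have "recf 1 (\<lambda>xs. ?N (xs ! 0))"
    by (intro recf_Least recp_conj recp_disj recp_not recp_le ext recf_diff recf_mult recf_Suc
        recf_const recf_hd w ex)
  then have "recp 1 (\<lambda>xs. ?yes (?N (xs ! 0)) (xs ! 0))"
    by (intro ext recf_mult recf_Suc recf_const recf_nth) simp_all
  then have "computable (\<lambda>w. of_bool (?yes (?N w) w))"
    unfolding recp_def by (rule computable_if_recf)
  then show ?thesis
    unfolding decidable_def yes
    by (intro exI[of _ "\<lambda>w. of_bool (\<exists>x\<in>X. agrees x w)"])
       (simp add: map_of_in_language_iff[OF assms(5)])
qed

end
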